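(* For each integer $j>1$, the function $p_{2j+1}(x)$, $0\le x\le 1$, is a unique $\mathbb Q$-linear combination of the functions $$x\mapsto\int_0^\infty I_0(xt)[I_0(t)]^{2m+1}\left[\frac{K_{0}(t)}{\pi}\right]^{2(j-m)}xt\,dt,\qquad m\in\mathbb Z\cap[0,(j-1)/2].$$ When $j=1$, the same is true for $0\le x<1$.
   Context: $J_0$ is the Bessel function of the first kind of order zero; $I_0(t)=\frac1\pi\int_0^\pi e^{t\cos\theta}\,d\theta$ and $K_0(t)=\int_0^\infty e^{-t\cosh u}\,du$ ($t>0$) are the modified Bessel functions of order zero. For an integer $n\ge2$, Kluyver's $n$-step density for planar uniform random walks is $p_n(x)=\int_0^\infty J_0(xt)[J_0(t)]^n\,xt\,dt$. *)

theory Defs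
  imports "HOL-Analysis.Analysis"
begin

definition bessel_J0 :: "real \<Rightarrow> real" where
  "bessel_J0 t = (\<Sum>k. (-1) ^ k / (fact k)\<^sup>2 * (t / 2) ^ (2 * k))"

definition bessel_I0 :: "real \<Rightarrow> real" where
  "bessel_I0 t = 1 / pi * integral {0..pi} (\<lambda>\<theta>. exp (t * cos \<theta>))"

text \<open>Only meaningful for \<open>t > 0\<close>.\<close>

definition bessel_K0 :: "real \<Rightarrow> real" where
  "bessel_K0 t = integral {0..} (\<lambda>u. exp (- t * cosh u))"

text \<open>
  The Henstock--Kurzweil integral over \<open>{0..}\<close> is the limit of the integrals over \<open>{0..T}\<close> as
  \<open>T\<close> tends to infinity. It thus covers \<open>n = 3\<close>, where the integral in Kluyver's formula
  converges only conditionally and a Lebesgue integral would not exist.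
\<close>

definition kluyver_density :: "nat \<Rightarrow> real \<Rightarrow> real" where
  "kluyver_density n x = integral {0..} (\<lambda>t. bessel_J0 (x * t) * bessel_J0 t ^ n * x * t)"

definition IK_integral :: "nat \<Rightarrow> nat \<Rightarrow> real \<Rightarrow> real" where
  "IK_integral j m x = integral {0..} (\<lambda>t. bessel_I0 (x * t) * bessel_I0 t ^ (2 * m + 1)
     * (bessel_K0 t / pi) ^ (2 * (j - m)) * x * t)"

end

theory Submission
  imports Defs "HOL-Complex_Analysis.Cauchy_Integral_Formula"
begin

text \<open>
  Kluyver's integrand contains the power \<open>J\<^sub>0 ^ (2 j + 1)\<close>. On the positive real axis \<open>J\<^sub>0\<close>
  is the real part of the Hankel function \<open>H\<close>, which is holomorphic in the upper half-plane,
  decays like \<open>exp (- Im z)\<close>, and is an imaginary multiple of \<open>K\<^sub>0\<close> on the imaginary axis,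
  where \<open>J\<^sub>0\<close> becomes \<open>I\<^sub>0\<close>. A product \<open>J\<^sub>0(x z) J\<^sub>0(z) ^ a H(z) ^ b z\<close> can therefore be
  rotated from the real to the imaginary axis as soon as \<open>H\<close> prevails, that is, for
  \<open>a + x < b\<close>, and also for \<open>a + x = b\<close> if there are at least five factors besides \<open>J\<^sub>0(x z)\<close>;
  the rotated integrand is a constant times \<open>I\<^sub>0(x y) I\<^sub>0(y) ^ a K\<^sub>0(y) ^ b y\<close>, and this
  constant is imaginary for odd \<open>b\<close> (\<open>bessel_product_rotation\<close>, \<open>bessel_product_imaginary\<close>).

  It remains to write \<open>J\<^sub>0 ^ (2 j + 1)\<close> as the real part of a rational combination of the
  products \<open>J\<^sub>0 ^ a H ^ b\<close> with \<open>a + b = 2 j + 1\<close> and \<open>a < b\<close>. With \<open>u = Re h\<close>, the number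
  \<open>h (2 u - h)\<close> is \<open>h\<close> times its conjugate, hence real. So the real part of a primitive of
  \<open>h ^ j (2 u - h) ^ j\<close> is constant on the line \<open>Re h = u\<close>; the primitive that vanishes at 0
  is divisible by \<open>h ^ (j + 1)\<close>, which gives the combination (\<open>power_eq_Re_rotation_sum\<close>).
  Taking real parts after the rotation, only even exponents \<open>b = 2 (j - m)\<close> survive, with
  \<open>a = 2 m + 1\<close> (\<open>kluyver_density_eq_IK_sum\<close>).

  The analytic estimates come from one integration by parts (\<open>norm_oscillatory_integral_le\<close>).
  Applied to the truncations of \<open>\<integral> exp (\<i> z cosh u) du\<close> it yields the continuation of \<open>K\<^sub>0\<close> to
  the closed upper half-plane with sharp bounds, and applied to Bessel's integral it yields
  the matching bounds for \<open>J\<^sub>0\<close>. The relation \<open>Re H = J\<^sub>0\<close> follows from Cauchy's theorem on a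
  rectangle (\<open>Im_K0_upper_real\<close>).

  For uniqueness, the coefficients of the power series in \<open>x\<close> turn a linear relation between
  the integrals into the vanishing of all even moments of a combination of the weights
  \<open>I\<^sub>0 ^ (2 m + 1) (K\<^sub>0 / \<pi>) ^ (2 (j - m)) t\<close>. For large \<open>t\<close> the weight with the largest \<open>m\<close>
  dominates, so the combination has constant sign near infinity, and high moments see only
  that part (\<open>IK_integrals_independent\<close>).
\<close>

section \<open>Oscillatory integrals and improper integrals\<close>

text \<open>
  Van der Corput's first-derivative estimate with a complex frequency. Since \<open>exp (\<i> z \<phi>)\<close> is
  the derivative of \<open>exp (\<i> z \<phi>) / (\<i> z \<phi>')\<close> up to the error \<open>exp (\<i> z \<phi>) \<phi>'' / (\<i> z \<phi>'\<^sup>2)\<close>,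
  one integration by parts gains the factor \<open>1 / (|z| \<phi>' a)\<close>; convexity of \<open>\<phi>\<close> makes
  \<open>\<phi>'' / \<phi>'\<^sup>2\<close> nonnegative with integral \<open>1 / \<phi>' a - 1 / \<phi>' b\<close>, so the error obeys the same
  bound. The phases \<open>cosh\<close> and \<open>- cos\<close> give all the decay of Bessel functions that the contour
  argument needs, with the sharp exponential factor kept in \<open>M\<close>.
\<close>

lemma norm_oscillatory_integral_le:
  fixes \<phi> \<phi>' \<phi>'' :: "real \<Rightarrow> real" and z :: complex
  assumes "a \<le> b" and "z \<noteq> 0" and pos: "0 < \<phi>' a"
    and d1: "\<And>u. u \<in> {a..b} \<Longrightarrow> (\<phi> has_real_derivative \<phi>' u) (at u)"
    and d2: "\<And>u. u \<in> {a..b} \<Longrightarrow> (\<phi>' has_real_derivative \<phi>'' u) (at u)"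
    and nonneg: "\<And>u. u \<in> {a..b} \<Longrightarrow> 0 \<le> \<phi>'' u"
    and M: "\<And>u. u \<in> {a..b} \<Longrightarrow> norm (exp (\<i> * z * of_real (\<phi> u))) \<le> M"
  shows "norm (integral {a..b} (\<lambda>u. exp (\<i> * z * of_real (\<phi> u)))) \<le> 2 * M / (norm z * \<phi>' a)"
proof -
  let ?E = "\<lambda>u. exp (\<i> * z * of_real (\<phi> u))"
  have mono: "\<phi>' u \<ge> \<phi>' a" if "u \<in> {a..b}" for u
  proof (rule DERIV_nonneg_imp_nondecreasing[of a u \<phi>'])
    show "\<exists>y. (\<phi>' has_real_derivative y) (at x) \<and> 0 \<le> y" if "a \<le> x" "x \<le> u" for x
      using d2[of x] nonneg[of x] that \<open>u \<in> {a..b}\<close> by auto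
  qed (use that in auto)
  have pos': "\<phi>' u > 0" if "u \<in> {a..b}" for u
    using mono[OF that] pos by linarith
  have "M \<ge> 0" using order_trans[OF norm_ge_zero M[of a]] \<open>a \<le> b\<close> by simp
  have cont: "continuous_on {a..b} ?E"
  proof (intro continuous_intros)
    show "continuous_on {a..b} \<phi>"
      using d1 by (meson DERIV_isCont continuous_at_imp_continuous_on)
  qed
  \<comment> \<open>Minus the derivative of the factor \<open>1 / (\<i> z \<phi>')\<close>, times the exponential: the error of the integration by parts.\<close>
  define q where "q = (\<lambda>u. ?E u * of_real (\<phi>'' u) / (\<i> * z * of_real (\<phi>' u) ^ 2))"
  have dq: "((\<lambda>u. ?E u / (\<i> * z * of_real (\<phi>' u))) has_vector_derivative (?E u - q u))
        (at u within {a..b})" if u: "u \<in> {a..b}" for u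
  proof -
    have lin: "((\<lambda>u. \<i> * z * of_real (\<psi> u)) has_vector_derivative \<i> * z * of_real \<psi>') (at u within {a..b})"
      if "(\<psi> has_real_derivative \<psi>') (at u)" for \<psi> \<psi>'
      by (rule has_vector_derivative_mult_right[OF has_vector_derivative_of_real[OF
          has_field_derivative_at_within[OF that]]])
    have ex: "(?E has_vector_derivative (\<i> * z * of_real (\<phi>' u) * ?E u)) (at u within {a..b})"
      by (rule field_vector_diff_chain_within[OF lin[OF d1[OF u]], unfolded o_def])
        (simp add: DERIV_exp has_field_derivative_at_within)
    have "(inverse has_field_derivative - (inverse (\<i> * z * of_real (\<phi>' u)) ^ 2))
        (at (\<i> * z * of_real (\<phi>' u)) within (\<lambda>u. \<i> * z * of_real (\<phi>' u)) ` {a..b})"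
      using pos'[OF u] \<open>z \<noteq> 0\<close>
      by (auto intro!: derivative_eq_intros simp: power2_eq_square)
    note inv = field_vector_diff_chain_within[OF lin[OF d2[OF u]] this, unfolded o_def]
    show ?thesis
      unfolding divide_inverse
      by (rule has_vector_derivative_eq_rhs[OF has_vector_derivative_mult[OF ex inv]])
        (use pos'[OF u] \<open>z \<noteq> 0\<close> in \<open>simp add: q_def power2_eq_square field_simps\<close>)
  qed
  define B where "B = ?E b / (\<i> * z * of_real (\<phi>' b)) - ?E a / (\<i> * z * of_real (\<phi>' a))"
  have I1: "((\<lambda>u. ?E u - q u) has_integral B) {a..b}"
    unfolding B_def using fundamental_theorem_of_calculus[OF \<open>a \<le> b\<close> dq] by simp
  have I2: "(?E has_integral integral {a..b} ?E) {a..b}"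
    using integrable_continuous_interval[OF cont] by (simp add: integrable_integral)
  have I3: "(q has_integral (integral {a..b} ?E - B)) {a..b}"
    using has_integral_diff[OF I2 I1] by simp
  \<comment> \<open>A majorant of \<open>norm q\<close> with the primitive \<open>- M / (norm z * \<phi>')\<close>.\<close>
  define r where "r = (\<lambda>u. M / norm z * (\<phi>'' u / \<phi>' u ^ 2))"
  have I4: "(r has_integral M / norm z * (- inverse (\<phi>' b) - (- inverse (\<phi>' a)))) {a..b}"
    unfolding r_def
  proof (intro has_integral_mult_right fundamental_theorem_of_calculus[OF \<open>a \<le> b\<close>])
    fix u assume u: "u \<in> {a..b}"
    have "((\<lambda>u. - inverse (\<phi>' u)) has_real_derivative \<phi>'' u / \<phi>' u ^ 2) (at u within {a..b})"
      using has_field_derivative_at_within[OF d2[OF u], of "{a..b}"] pos'[OF u]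
      by (auto intro!: derivative_eq_intros simp: power2_eq_square field_simps)
    then show "((\<lambda>u. - inverse (\<phi>' u)) has_vector_derivative \<phi>'' u / \<phi>' u ^ 2) (at u within {a..b})"
      by (simp add: has_real_derivative_iff_has_vector_derivative)
  qed
  have qr: "norm (q u) \<le> r u" if u: "u \<in> {a..b}" for u
  proof -
    have "norm (q u) = norm (?E u) * (\<phi>'' u / (norm z * \<phi>' u ^ 2))"
      using nonneg[OF u] by (simp add: q_def norm_mult norm_divide norm_power)
    also have "\<dots> \<le> M * (\<phi>'' u / (norm z * \<phi>' u ^ 2))"
      using nonneg[OF u] by (intro mult_right_mono M u) auto
    finally show ?thesis by (simp add: r_def)
  qed
  have n3: "norm (integral {a..b} ?E - B) \<le> M / norm z * (- inverse (\<phi>' b) - (- inverse (\<phi>' a)))"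
    using integral_norm_bound_integral[of q "{a..b}" r] I3 I4 qr by (metis has_integral_integrable integral_unique)
  have end1: "norm (?E u / (\<i> * z * of_real (\<phi>' u))) \<le> M / (norm z * \<phi>' u)" if u: "u \<in> {a..b}" for u
    using M[OF u] pos'[OF u] by (auto simp: norm_divide norm_mult intro!: divide_right_mono)
  have nB: "norm B \<le> M / (norm z * \<phi>' b) + M / (norm z * \<phi>' a)"
    unfolding B_def using \<open>a \<le> b\<close>
    by (intro order_trans[OF norm_triangle_ineq4] add_mono end1) auto
  have "norm (integral {a..b} ?E) \<le> norm (integral {a..b} ?E - B) + norm B"
    using norm_triangle_ineq[of "integral {a..b} ?E - B" B] by simp
  also have "\<dots> \<le> 2 * M / (norm z * \<phi>' a)"
    using n3 nB by (simp add: divide_inverse algebra_simps)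
  finally show ?thesis .
qed

lemma holomorphic_oscillatory_integral:
  fixes \<phi> :: "real \<Rightarrow> real"
  assumes "continuous_on {a..b} \<phi>"
  shows "(\<lambda>z. integral {a..b} (\<lambda>u. exp (\<i> * z * of_real (\<phi> u)))) holomorphic_on UNIV"
proof -
  have snd: "continuous_on (UNIV \<times> {a..b}) (\<lambda>p::complex \<times> real. \<phi> (snd p))"
    by (rule continuous_on_compose2[OF assms]) (auto intro!: continuous_intros)
  have "(\<lambda>z. integral (cbox a b) (\<lambda>u. exp (\<i> * z * of_real (\<phi> u)))) holomorphic_on UNIV"
  proof (rule leibniz_rule_holomorphic)
    show "((\<lambda>z. exp (\<i> * z * of_real (\<phi> t))) has_field_derivative 
        \<i> * of_real (\<phi> t) * exp (\<i> * z * of_real (\<phi> t))) (at z within UNIV)" for z t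
      by (auto intro!: derivative_eq_intros)
    show "(\<lambda>u. exp (\<i> * z * of_real (\<phi> u))) integrable_on cbox a b" for z
      using assms by (intro integrable_continuous continuous_intros) auto
    show "continuous_on (UNIV \<times> cbox a b) (\<lambda>(z, t). \<i> * of_real (\<phi> t) * exp (\<i> * z * of_real (\<phi> t)))"
      using snd by (auto simp: case_prod_unfold intro!: continuous_intros)
  qed auto
  then show ?thesis by simp
qed

lemma integral_complex_of_real_eq:
  "f integrable_on S \<Longrightarrow> integral S (\<lambda>x. complex_of_real (f x)) = of_real (integral S f)"
  by (intro integral_unique has_integral_of_real integrable_integral)

text \<open>
  Hake's theorem on a half-line. It turns an improper integral that converges only
  conditionally into a statement about integrals over compact intervals, where contours can be
  deformed.
\<close>

lemma has_integral_atLeast_iff_tendsto: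
  fixes f :: "real \<Rightarrow> 'a::banach"
  assumes "\<And>T. f integrable_on {0..T}"
  shows "(f has_integral L) {0..} \<longleftrightarrow> ((\<lambda>T. integral {0..T} f) \<longlongrightarrow> L) at_top"
proof -
  have restrict: "integral (cbox a b) (\<lambda>x. if x \<in> {0..} then f x else 0) = integral {0..b} f"
    if "a \<le> 0" for a b
  proof -
    have "{0..} \<inter> cbox a b = {0..b}" using that by auto
    then show ?thesis by (metis integral_restrict_Int)
  qed
  have int: "(\<lambda>x. if x \<in> {0..} then f x else 0) integrable_on cbox a b" for a b :: real
  proof -
    have "{0..} \<inter> cbox a b = cbox (max 0 a) b" by auto
    moreover have "f integrable_on cbox (max 0 a) b"
      unfolding cbox_interval by (rule integrable_subinterval_real[OF assms[of b]]) auto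
    ultimately show ?thesis by (metis integrable_restrict_Int)
  qed
  show ?thesis
  proof
    assume "(f has_integral L) {0..}"
    then have H: "\<forall>e>0. \<exists>B>0. \<forall>a b. ball 0 B \<subseteq> cbox a b \<longrightarrow>
        norm (integral (cbox a b) (\<lambda>x. if x \<in> {0..} then f x else 0) - L) < e"
      by (simp add: has_integral_alt')
    show "((\<lambda>T. integral {0..T} f) \<longlongrightarrow> L) at_top"
      unfolding tendsto_iff
    proof (intro allI impI)
      fix e :: real assume "e > 0"
      with H obtain B where B: "B > 0" "\<And>a b. ball 0 B \<subseteq> cbox a b \<Longrightarrow>
        norm (integral (cbox a b) (\<lambda>x. if x \<in> {0..} then f x else 0) - L) < e" by blast
      show "\<forall>\<^sub>F T in at_top. dist (integral {0..T} f) L < e"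
        using eventually_ge_at_top[of B]
      proof eventually_elim
        case (elim T)
        have "ball 0 B \<subseteq> cbox (-B) T" using elim by (auto simp: dist_real_def)
        from B(2)[OF this] show ?case using restrict[of "-B" T] B(1) by (simp add: dist_norm)
      qed
    qed
  next
    assume lim: "((\<lambda>T. integral {0..T} f) \<longlongrightarrow> L) at_top"
    show "(f has_integral L) {0..}"
      unfolding has_integral_alt'
    proof (intro conjI allI impI int)
      fix e :: real assume "e > 0"
      with lim obtain B where B: "\<And>T. T \<ge> B \<Longrightarrow> norm (integral {0..T} f - L) < e"
        unfolding tendsto_iff eventually_at_top_linorder by (auto simp: dist_norm)
      show "\<exists>B>0. \<forall>a b. ball 0 B \<subseteq> cbox a b \<longrightarrow>
            norm (integral (cbox a b) (\<lambda>x. if x \<in> {0..} then f x else 0) - L) < e"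
      proof (intro exI[of _ "max B 0 + 1"] conjI allI impI)
        fix a b :: real assume sub: "ball 0 (max B 0 + 1) \<subseteq> cbox a b"
        have "max B 0 \<in> cbox a b" "0 \<in> cbox a b"
          by (rule subsetD[OF sub]; simp add: dist_real_def)+
        then have "B \<le> b" "a \<le> 0" by auto
        then show "norm (integral (cbox a b) (\<lambda>x. if x \<in> {0..} then f x else 0) - L) < e"
          using restrict B by metis
      qed auto
    qed
  qed
qed

section \<open>The function \<open>K\<^sub>0\<close> on the closed upper half-plane\<close>

text \<open>
  \<open>K0_upper z\<close> is \<open>K\<^sub>0(- \<i> z)\<close>. The limit of truncated integrals is used because, for real
  \<open>z\<close>, the integral over the half-line converges without converging absolutely, and the
  boundary values on the real axis are exactly the ones that produce \<open>J\<^sub>0\<close>.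
\<close>

definition K0_upper :: "complex \<Rightarrow> complex" where
  "K0_upper z = lim (\<lambda>n. integral {0..real n} (\<lambda>u. exp (\<i> * z * of_real (cosh u))))"

text \<open>
  The bound does not deteriorate as \<open>Im z\<close> tends to 0. Hence the truncated integrals converge
  uniformly on \<open>{z. 0 \<le> Im z \<and> r \<le> norm z}\<close>, which gives continuity up to the real axis and
  holomorphy inside.
\<close>

lemma norm_K0_upper_tail_le:
  assumes "Im z \<ge> 0" "z \<noteq> 0" "0 < \<delta>" "\<delta> \<le> N"
  shows "norm (integral {\<delta>..N} (\<lambda>u. exp (\<i> * z * of_real (cosh u))))
    \<le> 2 * exp (- Im z * cosh \<delta>) / (norm z * sinh \<delta>)"
proof (rule norm_oscillatory_integral_le[where \<phi>'' = cosh])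
  show "norm (exp (\<i> * z * complex_of_real (cosh u))) \<le> exp (- Im z * cosh \<delta>)" if "u \<in> {\<delta>..N}" for u
    using that assms cosh_real_nonneg_le_iff[of \<delta> u] by (auto intro!: mult_left_mono)
qed (use assms in \<open>auto intro!: derivative_eq_intros\<close>)

lemma K0_upper_partial_diff:
  assumes "0 \<le> M" "M \<le> N"
  shows "integral {0..N} (\<lambda>u. exp (\<i> * z * of_real (cosh u))) - integral {0..M} (\<lambda>u. exp (\<i> * z * of_real (cosh u)))
     = integral {M..N} (\<lambda>u. exp (\<i> * z * of_real (cosh u)))"
proof -
  have "(\<lambda>u. exp (\<i> * z * of_real (cosh u))) integrable_on {0..N}"
    by (intro integrable_continuous_interval continuous_intros)
  from Henstock_Kurzweil_Integration.integral_combine[OF assms this] show ?thesis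
    by (metis add_diff_cancel_left')
qed

lemma norm_K0_upper_partial_diff_le:
  assumes "Im z \<ge> 0" "z \<noteq> 0" "0 < M" "M \<le> N"
  shows "norm (integral {0..N} (\<lambda>u. exp (\<i> * z * of_real (cosh u)))
     - integral {0..M} (\<lambda>u. exp (\<i> * z * of_real (cosh u)))) \<le> 2 / (norm z * sinh M)"
proof -
  have "norm (integral {M..N} (\<lambda>u. exp (\<i> * z * of_real (cosh u)))) \<le> 2 * exp (- Im z * cosh M) / (norm z * sinh M)"
    by (rule norm_K0_upper_tail_le) (use assms in auto)
  also have "\<dots> \<le> 2 * 1 / (norm z * sinh M)"
    using assms by (intro divide_right_mono mult_left_mono) auto
  finally show ?thesis using K0_upper_partial_diff[of M N z] assms by simp
qed

lemma sinh_real_at_top_tendsto_0: "((\<lambda>N. c / (r * sinh N)) \<longlongrightarrow> 0) at_top" if "r > 0" for c r :: real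
proof -
  have "filterlim (\<lambda>N. r * sinh N) at_top at_top"
    by (intro filterlim_tendsto_pos_mult_at_top[OF tendsto_const that] sinh_real_at_top)
  then show ?thesis by (intro tendsto_divide_0[OF tendsto_const] filterlim_at_top_imp_at_infinity)
qed

lemma K0_upper_LIMSEQ:
  assumes "Im z \<ge> 0" "z \<noteq> 0"
  shows "(\<lambda>n. integral {0..real n} (\<lambda>u. exp (\<i> * z * of_real (cosh u)))) \<longlonglongrightarrow> K0_upper z"
proof -
  let ?P = "\<lambda>N. integral {0..N} (\<lambda>u. exp (\<i> * z * of_real (cosh u)))"
  have "Cauchy (\<lambda>n. ?P (real n))"
  proof (rule CauchyI)
    fix e :: real assume "e > 0"
    have "\<forall>\<^sub>F N in at_top. 2 / (norm z * sinh N) < e"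
      using order_tendstoD(2)[OF sinh_real_at_top_tendsto_0[of "norm z" 2] \<open>e > 0\<close>] assms by simp
    then obtain N0 where N0: "\<And>N. N \<ge> N0 \<Longrightarrow> 2 / (norm z * sinh N) < e"
      by (auto simp: eventually_at_top_linorder)
    define M where "M = Suc (nat \<lceil>N0\<rceil>)"
    have ge: "norm (?P (real n) - ?P (real m)) < e" if "M \<le> m" "m \<le> n" for m n
    proof -
      have "real m \<ge> N0" "real m > 0" using that unfolding M_def by linarith+
      then show ?thesis
        using norm_K0_upper_partial_diff_le[OF assms, of "real m" "real n"] N0[of "real m"] that by force
    qed
    show "\<exists>M. \<forall>m\<ge>M. \<forall>n\<ge>M. norm (?P (real m) - ?P (real n)) < e"
      using ge by (metis nle_le norm_minus_commute)
  qed
  then show ?thesis unfolding K0_upper_def by (simp add: Cauchy_convergent convergent_LIMSEQ_iff[symmetric])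
qed

lemma norm_K0_upper_minus_partial_le:
  assumes "Im z \<ge> 0" "z \<noteq> 0" "0 < N"
  shows "norm (integral {0..N} (\<lambda>u. exp (\<i> * z * of_real (cosh u))) - K0_upper z) \<le> 2 / (norm z * sinh N)"
proof (rule tendsto_upperbound)
  show "(\<lambda>n. norm (integral {0..N} (\<lambda>u. exp (\<i> * z * of_real (cosh u))) -
       integral {0..real n} (\<lambda>u. exp (\<i> * z * of_real (cosh u)))))
     \<longlonglongrightarrow> norm (integral {0..N} (\<lambda>u. exp (\<i> * z * of_real (cosh u))) - K0_upper z)"
    using assms by (intro tendsto_intros K0_upper_LIMSEQ)
  show "\<forall>\<^sub>F n in sequentially. norm (integral {0..N} (\<lambda>u. exp (\<i> * z * of_real (cosh u))) -
       integral {0..real n} (\<lambda>u. exp (\<i> * z * of_real (cosh u)))) \<le> 2 / (norm z * sinh N)"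
    using eventually_ge_at_top[of "nat \<lceil>N\<rceil>"]
  proof eventually_elim
    case (elim n)
    then have "N \<le> real n" by linarith
    then show ?case
      by (subst norm_minus_commute) (rule norm_K0_upper_partial_diff_le[OF assms])
  qed
qed auto

lemma K0_upper_tendsto:
  assumes "Im z \<ge> 0" "z \<noteq> 0"
  shows "((\<lambda>N. integral {0..N} (\<lambda>u. exp (\<i> * z * of_real (cosh u)))) \<longlongrightarrow> K0_upper z) at_top"
proof (rule Lim_null[THEN iffD2], rule Lim_null_comparison)
  show "\<forall>\<^sub>F N in at_top. norm (integral {0..N} (\<lambda>u. exp (\<i> * z * of_real (cosh u))) - K0_upper z)
      \<le> 2 / (norm z * sinh N)"
    using eventually_gt_at_top[of 0] by eventually_elim (rule norm_K0_upper_minus_partial_le[OF assms])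
  show "((\<lambda>N. 2 / (norm z * sinh N)) \<longlongrightarrow> 0) at_top"
    by (rule sinh_real_at_top_tendsto_0) (use assms in auto)
qed

lemma uniform_limit_K0_upper:
  assumes "r > 0"
  shows "uniform_limit {z. 0 \<le> Im z \<and> r \<le> norm z}
    (\<lambda>N z. integral {0..N} (\<lambda>u. exp (\<i> * z * of_real (cosh u)))) K0_upper at_top"
proof (rule uniform_limitI)
  fix e :: real assume "e > 0"
  have "\<forall>\<^sub>F N in at_top. 2 / (r * sinh N) < e"
    using order_tendstoD(2)[OF sinh_real_at_top_tendsto_0[of r 2] \<open>e > 0\<close>] assms by simp
  then show "\<forall>\<^sub>F N in at_top. \<forall>z\<in>{z. 0 \<le> Im z \<and> r \<le> norm z}.
      dist (integral {0..N} (\<lambda>u. exp (\<i> * z * of_real (cosh u)))) (K0_upper z) < e"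
    using eventually_gt_at_top[of 0]
  proof eventually_elim
    case (elim N)
    show ?case
    proof
      fix z assume z: "z \<in> {z. 0 \<le> Im z \<and> r \<le> norm z}"
      then have "z \<noteq> 0" using assms by auto
      then have "dist (integral {0..N} (\<lambda>u. exp (\<i> * z * of_real (cosh u)))) (K0_upper z) \<le> 2 / (norm z * sinh N)"
        using norm_K0_upper_minus_partial_le[of z N] z elim by (simp add: dist_norm)
      also have "\<dots> \<le> 2 / (r * sinh N)"
        using z elim assms \<open>z \<noteq> 0\<close> by (intro divide_left_mono mult_right_mono mult_pos_pos) auto
      finally show "dist (integral {0..N} (\<lambda>u. exp (\<i> * z * of_real (cosh u)))) (K0_upper z) < e"
        using elim by simp
    qed
  qed
qed

lemma continuous_on_K0_upper: "continuous_on {z. 0 \<le> Im z \<and> z \<noteq> 0} K0_upper"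
  unfolding continuous_on_eq_continuous_within
proof
  fix z :: complex assume z: "z \<in> {z. 0 \<le> Im z \<and> z \<noteq> 0}"
  define r where "r = norm z / 2"
  have "r > 0" using z by (simp add: r_def)
  have "continuous_on {z. 0 \<le> Im z \<and> r \<le> norm z} K0_upper"
    by (rule uniform_limit_theorem[OF _ uniform_limit_K0_upper[OF \<open>r > 0\<close>]])
      (auto intro!: always_eventually holomorphic_on_imp_continuous_on
        holomorphic_on_subset[OF holomorphic_oscillatory_integral] continuous_intros)
  then have "continuous (at z within {z. 0 \<le> Im z \<and> r \<le> norm z}) K0_upper"
    using z by (simp add: continuous_on_eq_continuous_within r_def)
  moreover have "at z within {z. 0 \<le> Im z \<and> r \<le> norm z} = at z within {z. 0 \<le> Im z \<and> z \<noteq> 0}"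
  proof (rule at_within_nhd)
    show "z \<in> {w. r < norm w}" using z by (simp add: r_def)
    show "open {w::complex. r < norm w}" by (intro open_Collect_less continuous_intros)
    show "{z. 0 \<le> Im z \<and> r \<le> norm z} \<inter> {w. r < norm w} - {z} = {z. 0 \<le> Im z \<and> z \<noteq> 0} \<inter> {w. r < norm w} - {z}"
      using \<open>r > 0\<close> by auto
  qed
  ultimately show "continuous (at z within {z. 0 \<le> Im z \<and> z \<noteq> 0}) K0_upper" by simp
qed

lemma holomorphic_K0_upper: "K0_upper holomorphic_on {z. Im z > 0}"
proof (rule holomorphic_uniform_sequence[OF open_halfspace_Im_gt])
  show "(\<lambda>z. integral {0..real n} (\<lambda>u. exp (\<i> * z * of_real (cosh u)))) holomorphic_on {z. Im z > 0}" for n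
    by (rule holomorphic_on_subset[OF holomorphic_oscillatory_integral]) (auto intro!: continuous_intros)
  fix z :: complex assume z: "z \<in> {z. 0 < Im z}"
  define r where "r = Im z / 2"
  have r: "r > 0" using z by (simp add: r_def)
  have sub: "r \<le> Im w" if "w \<in> cball z r" for w
  proof -
    have "\<bar>Im (z - w)\<bar> \<le> r" using that abs_Im_le_cmod[of "z - w"] by (simp add: dist_norm)
    then have "Im z - Im w \<le> r" by (simp add: abs_le_iff)
    then show ?thesis by (simp add: r_def)
  qed
  have "uniform_limit (cball z r) (\<lambda>N z. integral {0..N} (\<lambda>u. exp (\<i> * z * of_real (cosh u)))) K0_upper at_top"
  proof (rule uniform_limit_on_subset[OF uniform_limit_K0_upper[OF r]])
    show "cball z r \<subseteq> {z. 0 \<le> Im z \<and> r \<le> norm z}"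
    proof
      fix w assume "w \<in> cball z r"
      from sub[OF this] show "w \<in> {z. 0 \<le> Im z \<and> r \<le> norm z}"
        using r abs_Im_le_cmod[of w] by auto
    qed
  qed
  then have "uniform_limit (cball z r) (\<lambda>n z. integral {0..real n} (\<lambda>u. exp (\<i> * z * of_real (cosh u)))) K0_upper sequentially"
    by (rule filterlim_compose[OF _ filterlim_real_sequentially])
  moreover have "cball z r \<subseteq> {z. 0 < Im z}" using sub r by force
  ultimately show "\<exists>d>0. cball z d \<subseteq> {z. 0 < Im z} \<and>
     uniform_limit (cball z d) (\<lambda>n z. integral {0..real n} (\<lambda>u. exp (\<i> * z * of_real (cosh u)))) K0_upper sequentially"
    using r by blast
qed

text \<open>
  Bound the integrand trivially on \<open>{0..\<delta>}\<close> and use the oscillation beyond \<open>\<delta>\<close>. The free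
  parameter serves two purposes: \<open>\<delta> = 1 / sqrt (norm z)\<close> gives the true decay at infinity, and
  larger values control the logarithmic singularity at 0.
\<close>

lemma norm_K0_upper_le:
  assumes "Im z \<ge> 0" "z \<noteq> 0" "0 < \<delta>"
  shows "norm (K0_upper z) \<le> exp (- Im z) * (\<delta> + 2 / (norm z * sinh \<delta>))"
proof (rule tendsto_upperbound)
  let ?E = "\<lambda>u. exp (\<i> * z * of_real (cosh u))"
  show "((\<lambda>N. norm (integral {0..N} ?E)) \<longlongrightarrow> norm (K0_upper z)) at_top"
    by (intro tendsto_intros K0_upper_tendsto assms)
  show "\<forall>\<^sub>F N in at_top. norm (integral {0..N} ?E) \<le> exp (- Im z) * (\<delta> + 2 / (norm z * sinh \<delta>))"
    using eventually_ge_at_top[of \<delta>]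
  proof eventually_elim
    case (elim N)
    have 1: "norm (integral {\<delta>..N} ?E) \<le> exp (- Im z) * (2 / (norm z * sinh \<delta>))"
    proof -
      have "Im z * 1 \<le> Im z * cosh \<delta>" using assms cosh_real_ge_1 by (intro mult_left_mono) auto
      then have "2 * exp (- Im z * cosh \<delta>) / (norm z * sinh \<delta>) \<le> 2 * exp (- Im z) / (norm z * sinh \<delta>)"
        using assms by (intro divide_right_mono mult_left_mono) auto
      with norm_K0_upper_tail_le[OF assms elim] show ?thesis by (simp add: mult.commute)
    qed
    have "norm (integral {0..\<delta>} ?E) \<le> exp (- Im z) * (\<delta> - 0)"
    proof (rule integral_bound)
      show "norm (exp (\<i> * z * complex_of_real (cosh t))) \<le> exp (- Im z)" for t
        using mult_left_mono[OF cosh_real_ge_1[of t] assms(1)] by simp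
    qed (use assms in \<open>auto intro!: continuous_intros\<close>)
    then have 2: "norm (integral {0..\<delta>} ?E) \<le> exp (- Im z) * \<delta>" by simp
    have "integral {0..N} ?E = integral {0..\<delta>} ?E + integral {\<delta>..N} ?E"
      using K0_upper_partial_diff[of \<delta> N z] assms elim by (simp add: algebra_simps)
    then show ?case using 1 2 norm_triangle_ineq[of "integral {0..\<delta>} ?E" "integral {\<delta>..N} ?E"]
      by (simp add: algebra_simps)
  qed
qed auto

lemma K0_upper_imaginary:
  assumes "y > 0"
  shows "K0_upper (\<i> * of_real y) = of_real (bessel_K0 y)"
    and "((\<lambda>u. exp (- y * cosh u)) has_integral bessel_K0 y) {0..}"
proof -
  have eq: "integral {0..N} (\<lambda>u. exp (\<i> * (\<i> * of_real y) * of_real (cosh u)))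
      = of_real (integral {0..N} (\<lambda>u. exp (- y * cosh u)))" for N
  proof -
    have "(\<lambda>u. exp (\<i> * (\<i> * of_real y) * of_real (cosh u))) = (\<lambda>u. complex_of_real (exp (- y * cosh u)))"
      by (auto simp: fun_eq_iff exp_of_real[symmetric])
    then show ?thesis
      by (simp only:) (intro integral_complex_of_real_eq integrable_continuous_interval continuous_intros)
  qed
  have lim: "((\<lambda>N. complex_of_real (integral {0..N} (\<lambda>u. exp (- y * cosh u)))) \<longlongrightarrow> K0_upper (\<i> * of_real y)) at_top"
    using K0_upper_tendsto[of "\<i> * of_real y"] assms unfolding eq by simp
  then have "((\<lambda>N. integral {0..N} (\<lambda>u. exp (- y * cosh u))) \<longlongrightarrow> Re (K0_upper (\<i> * of_real y))) at_top"
    using tendsto_Re by fastforce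
  then have int: "((\<lambda>u. exp (- y * cosh u)) has_integral Re (K0_upper (\<i> * of_real y))) {0..}"
    by (subst has_integral_atLeast_iff_tendsto) (auto intro!: integrable_continuous_interval continuous_intros)
  have "Im (K0_upper (\<i> * of_real y)) = 0"
    using tendsto_unique[OF _ tendsto_Im[OF lim]] by simp
  moreover have "Re (K0_upper (\<i> * of_real y)) = bessel_K0 y"
    using int by (simp add: bessel_K0_def integral_unique)
  ultimately show "K0_upper (\<i> * of_real y) = of_real (bessel_K0 y)" by (simp add: complex_eq_iff)
  show "((\<lambda>u. exp (- y * cosh u)) has_integral bessel_K0 y) {0..}"
    using int \<open>Re (K0_upper (\<i> * of_real y)) = bessel_K0 y\<close> by simp
qed

section \<open>The function \<open>J\<^sub>0\<close> in the complex plane\<close>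

text \<open>
  Jordan's inequality, from the concavity of the sine.
\<close>

lemma sin_ge_linear:
  fixes x :: real
  assumes "0 \<le> x" "x \<le> pi / 2"
  shows "2 / pi * x \<le> sin x"
proof -
  have "convex_on {0..pi/2} (\<lambda>x::real. - sin x)"
    by (rule f''_ge0_imp_convex[where f' = "\<lambda>x. - cos x" and f'' = sin])
      (auto intro!: derivative_eq_intros sin_ge_zero)
  from convex_onD[OF this, of "2 / pi * x" 0 "pi / 2"] show ?thesis
    using assms by (simp add: field_simps)
qed

lemma has_integral_primitive_along_line:
  fixes F g :: "complex \<Rightarrow> complex"
  assumes "\<And>w. w \<in> S \<Longrightarrow> (F has_field_derivative g w) (at w within S)"
    and "\<And>s. s \<in> {a..b} \<Longrightarrow> p + of_real s * c \<in> S" and "a \<le> b"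
  shows "((\<lambda>s. c * g (p + of_real s * c)) has_integral
     F (p + of_real b * c) - F (p + of_real a * c)) {a..b}"
proof (rule fundamental_theorem_of_calculus[OF \<open>a \<le> b\<close>])
  fix s assume s: "s \<in> {a..b}"
  have "((\<lambda>s. p + of_real s * c) has_vector_derivative c) (at s within {a..b})"
    by (auto intro!: derivative_eq_intros)
  moreover have "(F has_field_derivative g (p + of_real s * c))
      (at (p + of_real s * c) within (\<lambda>s. p + of_real s * c) ` {a..b})"
    by (rule has_field_derivative_subset[OF assms(1)[OF assms(2)[OF s]]]) (use assms(2) in blast)
  ultimately have "((F \<circ> (\<lambda>s. p + of_real s * c)) has_vector_derivative c * g (p + of_real s * c)) (at s within {a..b})"
    by (rule field_vector_diff_chain_within)
  then
  show "((\<lambda>s. F (p + of_real s * c)) has_vector_derivative c * g (p + of_real s * c)) (at s within {a..b})"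
    by (simp add: o_def)
qed

text \<open>
  Bessel's integral, which continues \<open>J\<^sub>0\<close> to an entire function whose restriction to the
  imaginary axis is \<open>I\<^sub>0\<close>.
\<close>

definition J0_complex :: "complex \<Rightarrow> complex" where
  "J0_complex z = of_real (1 / pi) * integral {0..pi} (\<lambda>\<theta>. exp (\<i> * z * of_real (cos \<theta>)))"

lemma holomorphic_J0_complex: "J0_complex holomorphic_on S"
proof -
  have "J0_complex holomorphic_on UNIV"
    unfolding J0_complex_def
    by (intro holomorphic_intros holomorphic_oscillatory_integral continuous_intros)
  then show ?thesis by (rule holomorphic_on_subset) simp
qed

lemma J0_complex_imaginary: "J0_complex (\<i> * of_real y) = of_real (bessel_I0 y)"
proof -
  have "((\<lambda>\<theta>. exp (y * cos \<theta>)) has_integral integral {0..pi} (\<lambda>\<theta>. exp (y * cos \<theta>))) {0..pi}"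
    by (intro integrable_integral integrable_continuous_interval continuous_intros)
  from has_integral_shift_real_ivl[OF this, of pi]
  have "((\<lambda>\<theta>. exp (- y * cos \<theta>)) has_integral integral {0..pi} (\<lambda>\<theta>. exp (y * cos \<theta>))) {-pi..-0}"
    by simp
  then have "((\<lambda>\<theta>. exp (- y * cos \<theta>)) has_integral integral {0..pi} (\<lambda>\<theta>. exp (y * cos \<theta>))) {0..pi}"
    using has_integral_reflect_real[of "\<lambda>\<theta>. exp (- y * cos \<theta>)" _ pi 0] by simp
  then have "((\<lambda>\<theta>. of_real (exp (- y * cos \<theta>))) has_integral complex_of_real (integral {0..pi} (\<lambda>\<theta>. exp (y * cos \<theta>)))) {0..pi}"
    by (rule has_integral_of_real)
  moreover have "(\<lambda>\<theta>. exp (\<i> * (\<i> * of_real y) * of_real (cos \<theta>))) = (\<lambda>\<theta>. complex_of_real (exp (- y * cos \<theta>)))"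
    by (auto simp: fun_eq_iff exp_of_real[symmetric])
  ultimately have "integral {0..pi} (\<lambda>\<theta>. exp (\<i> * (\<i> * of_real y) * of_real (cos \<theta>))) = complex_of_real (integral {0..pi} (\<lambda>\<theta>. exp (y * cos \<theta>)))"
    by (metis integral_unique)
  then show ?thesis by (simp add: J0_complex_def bessel_I0_def)
qed

text \<open>
  Integrate the derivative of \<open>sin \<theta> * cos \<theta> ^ (m + 1)\<close>.
\<close>

lemma integral_cos_power_add_2:
  "real (m + 2) * integral {0..pi} (\<lambda>\<theta>. cos \<theta> ^ (m + 2)) = real (m + 1) * integral {0..pi} (\<lambda>\<theta>. cos \<theta> ^ m)"
proof -
  have "((\<lambda>\<theta>. real (m + 2) * cos \<theta> ^ (m + 2) - real (m + 1) * cos \<theta> ^ m) has_integral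
      (sin pi * cos pi ^ (m + 1) - sin 0 * cos 0 ^ (m + 1))) {0..pi}"
  proof (rule fundamental_theorem_of_calculus)
    fix \<theta> :: real
    have "((\<lambda>\<theta>. sin \<theta> * cos \<theta> ^ (m + 1)) has_real_derivative
        cos \<theta> * cos \<theta> ^ (m + 1) + (real (m + 1) * cos \<theta> ^ m * (- sin \<theta>)) * sin \<theta>) (at \<theta>)"
      using DERIV_mult[OF DERIV_sin DERIV_power[OF DERIV_cos, where n = "m + 1"], of \<theta>] by (simp add: mult_ac)
    moreover have "cos \<theta> * cos \<theta> ^ (m + 1) + (real (m + 1) * cos \<theta> ^ m * (- sin \<theta>)) * sin \<theta>
        = real (m + 2) * cos \<theta> ^ (m + 2) - real (m + 1) * cos \<theta> ^ m"
    proof -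
      have "(real (m + 1) * cos \<theta> ^ m * (- sin \<theta>)) * sin \<theta> = - real (m + 1) * cos \<theta> ^ m * (sin \<theta>)\<^sup>2"
        by (simp add: power2_eq_square algebra_simps)
      also have "\<dots> = - real (m + 1) * cos \<theta> ^ m * (1 - (cos \<theta>)\<^sup>2)"
        by (simp only: sin_squared_eq)
      finally show ?thesis by (simp only:) (simp add: algebra_simps power2_eq_square)
    qed
    ultimately show "((\<lambda>\<theta>. sin \<theta> * cos \<theta> ^ (m + 1)) has_vector_derivative
       real (m + 2) * cos \<theta> ^ (m + 2) - real (m + 1) * cos \<theta> ^ m) (at \<theta> within {0..pi})"
      by (metis has_real_derivative_iff_has_vector_derivative has_vector_derivative_at_within)
  qed auto
  moreover have "((\<lambda>\<theta>. real (m + 2) * cos \<theta> ^ (m + 2) - real (m + 1) * cos \<theta> ^ m) has_integral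
      real (m + 2) * integral {0..pi} (\<lambda>\<theta>. cos \<theta> ^ (m + 2)) - real (m + 1) * integral {0..pi} (\<lambda>\<theta>. cos \<theta> ^ m)) {0..pi}"
    by (intro has_integral_diff has_integral_mult_right integrable_integral
        integrable_continuous_interval continuous_on_power continuous_on_cos continuous_on_id)
  ultimately have "sin pi * cos pi ^ (m + 1) - sin 0 * cos 0 ^ (m + 1) = real (m + 2) * integral {0..pi} (\<lambda>\<theta>. cos \<theta> ^ (m + 2))
      - real (m + 1) * integral {0..pi} (\<lambda>\<theta>. cos \<theta> ^ m)"
    by (rule has_integral_unique)
  then show ?thesis by simp
qed

lemma integral_cos_power_even:
  "integral {0..pi} (\<lambda>\<theta>. cos \<theta> ^ (2 * k)) = pi * fact (2 * k) / (4 ^ k * (fact k)\<^sup>2)"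
proof (induction k)
  case (Suc k)
  have "integral {0..pi} (\<lambda>\<theta>. cos \<theta> ^ (2 * Suc k)) = real (2 * k + 1) / real (2 * k + 2) * integral {0..pi} (\<lambda>\<theta>. cos \<theta> ^ (2 * k))"
    using integral_cos_power_add_2[of "2 * k"] by (simp add: field_simps)
  also have "\<dots> = pi * fact (2 * Suc k) / (4 ^ Suc k * (fact (Suc k))\<^sup>2)"
    unfolding Suc.IH by (simp add: divide_simps power2_eq_square) (simp add: algebra_simps)
  finally show ?case .
qed simp

lemma integral_cos_power_odd: "integral {0..pi} (\<lambda>\<theta>. cos \<theta> ^ (2 * k + 1)) = 0"
proof (induction k)
  case 0
  have "((\<lambda>\<theta>. cos \<theta>) has_integral (sin pi - sin 0)) {0..pi}"
    by (rule fundamental_theorem_of_calculus) (auto intro!: derivative_eq_intros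
        simp: has_real_derivative_iff_has_vector_derivative[symmetric])
  then show ?case by (simp add: integral_unique)
next
  case (Suc k)
  then show ?case using integral_cos_power_add_2[of "2 * k + 1"] by simp
qed

lemma J0_complex_sums: "(\<lambda>k. (-1) ^ k / (fact k)\<^sup>2 * (z / 2) ^ (2 * k)) sums J0_complex z"
proof -
  define f where "f = (\<lambda>n \<theta>. (\<i> * z * of_real (cos \<theta>)) ^ n /\<^sub>R fact n)"
  have lim: "uniform_limit (cbox 0 pi) (\<lambda>n \<theta>. \<Sum>i<n. f i \<theta>) (\<lambda>\<theta>. \<Sum>i. f i \<theta>) sequentially"
  proof (rule Weierstrass_m_test)
    show "summable (\<lambda>n. norm z ^ n /\<^sub>R fact n)" by (rule summable_exp_generic)
    show "norm (f n \<theta>) \<le> norm z ^ n /\<^sub>R fact n" for n \<theta>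
    proof -
      have "norm z * \<bar>cos \<theta>\<bar> \<le> norm z * 1" by (intro mult_left_mono) auto
      then have "(norm z * \<bar>cos \<theta>\<bar>) ^ n \<le> norm z ^ n" by (intro power_mono) auto
      then show ?thesis by (simp add: f_def norm_power norm_mult divide_right_mono)
    qed
  qed
  have c: "continuous_on (cbox 0 pi) (\<lambda>\<theta>. \<Sum>i<n. f i \<theta>)" for n
    unfolding f_def by (intro continuous_intros)
  obtain I K where I: "\<And>n. ((\<lambda>\<theta>. \<Sum>i<n. f i \<theta>) has_integral I n) (cbox 0 pi)"
     and K: "((\<lambda>\<theta>. \<Sum>i. f i \<theta>) has_integral K) (cbox 0 pi)" and IK: "I \<longlonglongrightarrow> K"
    using uniform_limit_integral_cbox[OF lim c] by auto
  define a where "a = (\<lambda>n. of_real (1 / pi) * ((\<i> * z) ^ n /\<^sub>R fact n) * of_real (integral {0..pi} (\<lambda>\<theta>. cos \<theta> ^ n)))"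
  have fi: "(f n has_integral ((\<i> * z) ^ n /\<^sub>R fact n) * of_real (integral {0..pi} (\<lambda>\<theta>. cos \<theta> ^ n))) (cbox 0 pi)" for n
  proof -
    have "((\<lambda>\<theta>. ((\<i> * z) ^ n /\<^sub>R fact n) * of_real (cos \<theta> ^ n)) has_integral
       ((\<i> * z) ^ n /\<^sub>R fact n) * of_real (integral {0..pi} (\<lambda>\<theta>. cos \<theta> ^ n))) {0..pi}"
      by (intro has_integral_mult_right has_integral_of_real integrable_integral
        integrable_continuous_interval continuous_intros)
    then show ?thesis by (simp add: f_def power_mult_distrib)
  qed
  have I_eq: "I = (\<lambda>n. \<Sum>i<n. ((\<i> * z) ^ i /\<^sub>R fact i) * of_real (integral {0..pi} (\<lambda>\<theta>. cos \<theta> ^ i)))"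
  proof
    show "I n = (\<Sum>i<n. ((\<i> * z) ^ i /\<^sub>R fact i) * of_real (integral {0..pi} (\<lambda>\<theta>. cos \<theta> ^ i)))" for n
    using has_integral_unique[OF I[of n] has_integral_sum[OF _ fi]] by simp
  qed
  have "(\<lambda>n. ((\<i> * z) ^ n /\<^sub>R fact n) * of_real (integral {0..pi} (\<lambda>\<theta>. cos \<theta> ^ n))) sums K"
    using IK unfolding sums_def I_eq .
  from sums_mult[OF this, of "of_real (1 / pi)"] have "a sums (of_real (1 / pi) * K)"
    unfolding a_def by (simp add: mult.assoc)
  moreover have "of_real (1 / pi) * K = J0_complex z"
  proof -
    have "(\<lambda>\<theta>. \<Sum>i. f i \<theta>) = (\<lambda>\<theta>. exp (\<i> * z * of_real (cos \<theta>)))"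
      by (simp add: f_def exp_def)
    with K have "integral {0..pi} (\<lambda>\<theta>. exp (\<i> * z * of_real (cos \<theta>))) = K" by (simp add: integral_unique)
    then show ?thesis by (simp add: J0_complex_def)
  qed
  ultimately have "a sums J0_complex z" by simp
  moreover have "a n = 0" if "n \<notin> range (\<lambda>k. 2 * k)" for n
  proof -
    have "odd n" using that by (auto elim: evenE)
    then obtain k where "n = 2 * k + 1" by (auto elim: oddE)
    then show ?thesis using integral_cos_power_odd[of k] by (simp add: a_def)
  qed
  ultimately have "(\<lambda>k. a (2 * k)) sums J0_complex z"
    using sums_mono_reindex[of "\<lambda>k. 2 * k" a] by (simp add: strict_mono_def)
  moreover have "a (2 * k) = (-1) ^ k / (fact k)\<^sup>2 * (z / 2) ^ (2 * k)" for k
  proof -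
    have "(\<i> * z) ^ (2 * k) = (-1) ^ k * z ^ (2 * k)"
      by (simp only: power_mult power_mult_distrib power2_i)
    moreover have "(4::complex) ^ k = 2 ^ (2 * k)" by (simp add: power_mult)
    ultimately show ?thesis
      unfolding a_def integral_cos_power_even
      by (simp add: power_divide scaleR_conv_of_real field_simps)
  qed
  ultimately show ?thesis by simp
qed

lemma J0_complex_real: "J0_complex (of_real t) = of_real (bessel_J0 t)"
proof -
  have S: "(\<lambda>k. complex_of_real ((-1) ^ k / (fact k)\<^sup>2 * (t / 2) ^ (2 * k))) sums J0_complex (of_real t)"
    using J0_complex_sums[of "of_real t"] by simp
  from sums_Re[OF S]
  have R: "(\<lambda>k. (-1) ^ k / (fact k)\<^sup>2 * (t / 2) ^ (2 * k)) sums Re (J0_complex (of_real t))"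
    by (simp only: Re_complex_of_real)
  then have "bessel_J0 t = Re (J0_complex (of_real t))"
    unfolding bessel_J0_def by (rule sums_unique[symmetric])
  moreover have "J0_complex (of_real t) = of_real (Re (J0_complex (of_real t)))"
    by (rule sums_unique2[OF S sums_of_real[OF R]])
  ultimately show ?thesis by simp
qed

lemma bessel_I0_sums: "(\<lambda>k. (t / 2) ^ (2 * k) / (fact k)\<^sup>2) sums bessel_I0 t"
proof -
  have eq: "(-1) ^ k / (fact k)\<^sup>2 * (\<i> * of_real t / 2) ^ (2 * k) = complex_of_real ((t / 2) ^ (2 * k) / (fact k)\<^sup>2)" for k
  proof -
    have "(\<i> * (complex_of_real t / 2)) ^ (2 * k) = (-1) ^ k * (complex_of_real t / 2) ^ (2 * k)"
      by (simp only: power_mult power_mult_distrib power2_i)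
    moreover have "(-1::complex) ^ k * (-1) ^ k = 1" by (induction k) auto
    ultimately show ?thesis by (simp add: field_simps)
  qed
  have "(\<lambda>k. complex_of_real ((t / 2) ^ (2 * k) / (fact k)\<^sup>2)) sums of_real (bessel_I0 t)"
    using J0_complex_sums[of "\<i> * of_real t"] unfolding eq J0_complex_imaginary .
  then show ?thesis by (simp only: sums_of_real_iff)
qed

text \<open>
  Folding at \<open>\<pi> / 2\<close> leaves a single stationary point of the phase, at the endpoint 0.
\<close>

lemma J0_complex_quarter:
  "J0_complex z = of_real (1 / pi) * (integral {0..pi/2} (\<lambda>\<theta>. exp (\<i> * z * of_real (cos \<theta>)))
     + integral {0..pi/2} (\<lambda>\<theta>. exp (\<i> * (- z) * of_real (cos \<theta>))))"
proof -
  let ?E = "\<lambda>\<theta>. exp (\<i> * z * of_real (cos \<theta>))"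
  have "integral {0..pi/2} ?E + integral {pi/2..pi} ?E = integral {0..pi} ?E"
    by (rule Henstock_Kurzweil_Integration.integral_combine)
      (auto intro!: integrable_continuous_interval continuous_intros)
  moreover have "integral {pi/2..pi} ?E = integral {pi/2 - pi..pi - pi} (\<lambda>\<theta>. ?E (\<theta> + pi))"
    by (rule integral_shift_real_ivl[symmetric])
  moreover have "\<dots> = integral {-(pi/2)..-0} (\<lambda>\<theta>. exp (\<i> * (- z) * of_real (cos (- \<theta>))))"
    by simp
  moreover have "\<dots> = integral {0..pi/2} (\<lambda>\<theta>. exp (\<i> * (- z) * of_real (cos \<theta>)))"
    by (rule Henstock_Kurzweil_Integration.integral_reflect_real)
  ultimately show ?thesis unfolding J0_complex_def by metis
qed

lemma norm_J0_complex_le_exp: "norm (J0_complex z) \<le> exp \<bar>Im z\<bar>"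
proof -
  have "norm (integral {0..pi} (\<lambda>\<theta>. exp (\<i> * z * of_real (cos \<theta>)))) \<le> exp \<bar>Im z\<bar> * (pi - 0)"
  proof (rule integral_bound)
    fix \<theta> :: real
    have "- (Im z * cos \<theta>) \<le> \<bar>Im z\<bar> * \<bar>cos \<theta>\<bar>" by (metis abs_ge_minus_self abs_mult)
    also have "\<dots> \<le> \<bar>Im z\<bar> * 1" by (intro mult_left_mono) auto
    finally show "norm (exp (\<i> * z * of_real (cos \<theta>))) \<le> exp \<bar>Im z\<bar>" by simp
  qed (auto intro!: continuous_intros)
  then show ?thesis by (simp add: J0_complex_def norm_divide field_simps)
qed

lemma norm_integral_exp_cos_le:
  assumes "1 \<le> norm z"
  shows "norm (integral {0..pi/2} (\<lambda>\<theta>. exp (\<i> * z * of_real (cos \<theta>)))) \<le> 5 * exp \<bar>Im z\<bar> / sqrt (norm z)"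
proof -
  let ?E = "\<lambda>\<theta>. exp (\<i> * z * of_real (cos \<theta>))"
  define \<delta> where "\<delta> = 1 / sqrt (norm z)"
  have "1 \<le> sqrt (norm z)" using assms by simp
  then have \<delta>: "0 < \<delta>" "\<delta> \<le> 1" using assms by (auto simp: \<delta>_def divide_le_eq)
  have "\<delta> \<le> pi / 2" using \<delta> pi_gt3 by linarith
  have bd: "norm (?E \<theta>) \<le> exp \<bar>Im z\<bar>" for \<theta>
  proof -
    have "- (Im z * cos \<theta>) \<le> \<bar>Im z\<bar> * \<bar>cos \<theta>\<bar>" by (metis abs_ge_minus_self abs_mult)
    also have "\<dots> \<le> \<bar>Im z\<bar> * 1" by (intro mult_left_mono) auto
    finally show ?thesis by simp
  qed
  have 1: "norm (integral {0..\<delta>} ?E) \<le> exp \<bar>Im z\<bar> * (\<delta> - 0)"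
    by (rule integral_bound) (use \<delta> bd in \<open>auto intro!: continuous_intros\<close>)
  have "norm (integral {\<delta>..pi/2} (\<lambda>\<theta>. exp (\<i> * (- z) * of_real (- cos \<theta>)))) \<le> 2 * exp \<bar>Im z\<bar> / (norm (- z) * sin \<delta>)"
  proof (rule norm_oscillatory_integral_le[where \<phi>'' = cos])
    show "norm (exp (\<i> * - z * complex_of_real (- cos u))) \<le> exp \<bar>Im z\<bar>" for u
      using bd[of u] by simp
    show "sin \<delta> > 0" using \<delta> \<open>\<delta> \<le> pi / 2\<close> by (intro sin_gt_zero) auto
  qed (use assms \<delta> \<open>\<delta> \<le> pi / 2\<close> in \<open>auto intro!: derivative_eq_intros cos_ge_zero\<close>)
  then have "norm (integral {\<delta>..pi/2} ?E) \<le> 2 * exp \<bar>Im z\<bar> / (norm z * sin \<delta>)" by simp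
  also have "\<dots> \<le> 2 * exp \<bar>Im z\<bar> / (norm z * (\<delta> / 2))"
  proof -
    have "1 / 2 * \<delta> \<le> 2 / pi * \<delta>" using \<delta> pi_less_4 by (intro mult_right_mono) (auto simp: field_simps)
    also have "\<dots> \<le> sin \<delta>" using \<delta> \<open>\<delta> \<le> pi / 2\<close> by (intro sin_ge_linear) auto
    finally have s: "\<delta> / 2 \<le> sin \<delta>" by simp
    moreover from s \<delta> have "0 < sin \<delta>" by linarith
    moreover have "0 < norm z" using assms by linarith
    ultimately show ?thesis using \<delta> by (intro divide_left_mono mult_left_mono mult_pos_pos) auto
  qed
  also have "\<dots> = 4 * exp \<bar>Im z\<bar> * \<delta>"
  proof -
    have "norm z * \<delta> = 1 / \<delta>" using assms by (simp add: \<delta>_def real_div_sqrt)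
    then show ?thesis by (simp add: field_simps)
  qed
  finally have 2: "norm (integral {\<delta>..pi/2} ?E) \<le> 4 * exp \<bar>Im z\<bar> * \<delta>" .
  have "integral {0..\<delta>} ?E + integral {\<delta>..pi/2} ?E = integral {0..pi/2} ?E"
    by (rule Henstock_Kurzweil_Integration.integral_combine)
      (use \<delta> \<open>\<delta> \<le> pi / 2\<close> in \<open>auto intro!: integrable_continuous_interval continuous_intros\<close>)
  then have "norm (integral {0..pi/2} ?E) \<le> exp \<bar>Im z\<bar> * \<delta> + 4 * exp \<bar>Im z\<bar> * \<delta>"
    using 1 2 norm_triangle_ineq[of "integral {0..\<delta>} ?E" "integral {\<delta>..pi/2} ?E"]
    by (simp add: algebra_simps)
  also have "\<dots> = 5 * exp \<bar>Im z\<bar> / sqrt (norm z)" by (simp add: \<delta>_def)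
  finally show ?thesis .
qed

lemma norm_J0_complex_le:
  assumes "z \<noteq> 0"
  shows "norm (J0_complex z) \<le> 4 * exp \<bar>Im z\<bar> / sqrt (norm z)"
proof (cases "1 \<le> norm z")
  case True
  have "norm (J0_complex z) \<le> 1 / pi * (5 * exp \<bar>Im z\<bar> / sqrt (norm z) + 5 * exp \<bar>Im (- z)\<bar> / sqrt (norm (- z)))"
    unfolding J0_complex_quarter norm_mult using True
    by (intro mult_mono order_trans[OF norm_triangle_ineq] add_mono norm_integral_exp_cos_le) (auto simp: norm_divide)
  also have "\<dots> = (10 / pi) * (exp \<bar>Im z\<bar> / sqrt (norm z))" by (simp add: field_simps)
  also have "\<dots> \<le> 4 * (exp \<bar>Im z\<bar> / sqrt (norm z))"
    using pi_gt3 by (intro mult_right_mono) (auto simp: field_simps)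
  finally show ?thesis by simp
next
  case False
  have "norm (J0_complex z) \<le> exp \<bar>Im z\<bar> * 1" using norm_J0_complex_le_exp[of z] by simp
  also have "\<dots> \<le> exp \<bar>Im z\<bar> * (4 / sqrt (norm z))"
  proof (intro mult_left_mono)
    have "sqrt (norm z) \<le> 1" "0 < sqrt (norm z)" using False assms by auto
    then show "1 \<le> 4 / sqrt (norm z)" by (subst pos_le_divide_eq) linarith+
  qed simp
  finally show ?thesis by (simp add: mult.commute)
qed

section \<open>Boundary values of \<open>K\<^sub>0\<close> on the real axis\<close>

lemma cosh_of_real_plus_imaginary:
  "cosh (of_real N + of_real \<theta> * \<i>) = of_real (cosh N * cos \<theta>) + \<i> * of_real (sinh N * sin \<theta>)"
  by (simp add: cosh_field_def sinh_field_def complex_eq_iff Re_exp Im_exp field_simps)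

text \<open>
  The connection between \<open>K\<^sub>0\<close> and \<open>J\<^sub>0\<close>. Integrate the entire function \<open>exp (\<i> t cosh w)\<close>
  around the rectangle with corners \<open>0\<close>, \<open>N\<close>, \<open>N + \<i> \<pi> / 2\<close> and \<open>\<i> \<pi> / 2\<close>. The bottom side
  tends to \<open>K0_upper t\<close>, the left side is a quarter period of Bessel's integral for \<open>J\<^sub>0\<close>, the
  top side is real because \<open>\<i> cosh (r + \<i> \<pi> / 2) = - sinh r\<close>, and the right side vanishes in
  the limit.
\<close>

lemma Im_K0_upper_real:
  assumes "t > 0"
  shows "Im (K0_upper (of_real t)) = pi / 2 * bessel_J0 t"
proof -
  define g where "g = (\<lambda>w. exp (\<i> * of_real t * cosh w))"
  have "g holomorphic_on UNIV" unfolding g_def cosh_conv_cos by (intro holomorphic_intros)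
  then obtain F where F: "\<And>w. (F has_field_derivative g w) (at w)"
    using holomorphic_convex_primitive'[of UNIV g] by auto
  note line = has_integral_primitive_along_line[where S = UNIV and F = F and g = g, OF F]
  note cosh_vert = cosh_of_real_plus_imaginary
  define A where "A = integral {0..pi/2} (\<lambda>\<theta>. exp (\<i> * of_real t * of_real (cos \<theta>)))"
  define err where "err = (\<lambda>N. F (of_real N + of_real (pi/2) * \<i>) - F (of_real N + of_real 0 * \<i>))"
  \<comment> \<open>The four sides, written as increments of the primitive \<open>F\<close>.\<close>
  have bottom: "integral {0..N} (\<lambda>u. exp (\<i> * of_real t * of_real (cosh u))) = F (of_real N) - F 0" if "N \<ge> 0" for N
    using integral_unique[OF line[of 0 N 0 1]] that cosh_vert[of _ 0] by (simp add: g_def)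
  have left: "F (of_real (pi/2) * \<i>) - F 0 = \<i> * A"
    using integral_unique[OF line[of 0 "pi/2" 0 \<i>]] cosh_vert[of 0] 
    by (simp add: g_def A_def)
  have top: "Im (F (of_real N + of_real (pi/2) * \<i>) - F (of_real (pi/2) * \<i>)) = 0" if "N \<ge> 0" for N
  proof -
    have "((\<lambda>s. 1 * g (of_real (pi/2) * \<i> + of_real s * 1)) has_integral
        F (of_real (pi/2) * \<i> + of_real N * 1) - F (of_real (pi/2) * \<i> + of_real 0 * 1)) {0..N}"
      using that by (intro line) auto
    moreover have "1 * g (of_real (pi/2) * \<i> + of_real s * 1) = of_real (exp (- t * sinh s))" for s
    proof -
      have "\<i> * of_real t * cosh (of_real (pi/2) * \<i> + of_real s * 1) = of_real (- t * sinh s)"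
        using cosh_vert[of s "pi/2"] by (simp add: add.commute complex_eq_iff)
      then show ?thesis unfolding g_def by (simp only: exp_of_real mult_1)
    qed
    ultimately have "((\<lambda>s. complex_of_real (exp (- t * sinh s))) has_integral
        F (of_real N + of_real (pi/2) * \<i>) - F (of_real (pi/2) * \<i>)) {0..N}"
      by (simp add: add.commute)
    from has_integral_Im[OF this] show ?thesis using has_integral_unique has_integral_0 by fastforce
  qed
  have right: "norm (err N) \<le> (pi / 2) / (t * sinh N)" if "N > 0" for N
  proof -
    define a where "a = t * sinh N * (2 / pi)"
    have "a > 0" using that assms by (simp add: a_def)
    have I: "((\<lambda>s. \<i> * g (of_real N + of_real s * \<i>)) has_integral err N) {0..pi/2}"
      unfolding err_def by (intro line) auto
    have J: "((\<lambda>s. exp (- a * s)) has_integral (- exp (- a * (pi/2)) / a - (- exp (- a * 0) / a))) {0..pi/2}"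
      using \<open>a > 0\<close> by (intro fundamental_theorem_of_calculus)
        (auto intro!: derivative_eq_intros simp: has_real_derivative_iff_has_vector_derivative[symmetric])
    have "norm (err N) \<le> integral {0..pi/2} (\<lambda>s. exp (- a * s))"
      unfolding integral_unique[OF I, symmetric]
    proof (rule integral_norm_bound_integral)
      fix s assume s: "s \<in> {0..pi/2}"
      have "norm (\<i> * g (of_real N + of_real s * \<i>)) = exp (- (t * sinh N * sin s))"
        unfolding g_def cosh_vert by (simp add: norm_mult)
      also have "\<dots> \<le> exp (- a * s)"
        using mult_left_mono[OF sin_ge_linear[of s], of "t * sinh N"] s that assms by (simp add: a_def)
      finally show "norm (\<i> * g (of_real N + of_real s * \<i>)) \<le> exp (- a * s)" .
    qed (use I J in \<open>auto simp: has_integral_integrable\<close>)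
    also have "\<dots> \<le> 1 / a"
      unfolding integral_unique[OF J] using \<open>a > 0\<close> by (simp add: divide_simps)
    also have "\<dots> = (pi / 2) / (t * sinh N)" by (simp add: a_def)
    finally show ?thesis .
  qed
  have "(err \<longlongrightarrow> 0) at_top"
  proof (rule Lim_null_comparison)
    show "\<forall>\<^sub>F N in at_top. norm (err N) \<le> (pi / 2) / (t * sinh N)"
      using eventually_gt_at_top[of 0] by eventually_elim (rule right)
  qed (rule sinh_real_at_top_tendsto_0[OF assms])
  then have "((\<lambda>N. Im (\<i> * A) - Im (err N)) \<longlongrightarrow> Im (\<i> * A) - Im 0) at_top"
    by (intro tendsto_intros)
  moreover have "\<forall>\<^sub>F N in at_top. Im (\<i> * A) - Im (err N) = Im (integral {0..N} (\<lambda>u. exp (\<i> * of_real t * of_real (cosh u))))"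
    using eventually_ge_at_top[of 0]
  proof eventually_elim
    case (elim N)
    have "F (of_real N) - F 0 = \<i> * A + (F (of_real N + of_real (pi/2) * \<i>) - F (of_real (pi/2) * \<i>)) - err N"
      unfolding left[symmetric] by (simp add: err_def)
    from arg_cong[OF this, of Im] show ?case using top[OF elim] by (simp add: bottom[OF elim])
  qed
  ultimately have "((\<lambda>N. Im (integral {0..N} (\<lambda>u. exp (\<i> * of_real t * of_real (cosh u))))) \<longlongrightarrow> Re A) at_top"
    using Lim_transform_eventually by fastforce
  moreover have "((\<lambda>N. Im (integral {0..N} (\<lambda>u. exp (\<i> * of_real t * of_real (cosh u))))) \<longlongrightarrow> Im (K0_upper (of_real t))) at_top"
    using assms by (intro tendsto_intros K0_upper_tendsto) auto
  ultimately have "Im (K0_upper (of_real t)) = Re A"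
    by (metis tendsto_unique trivial_limit_at_top_linorder)
  moreover have "bessel_J0 t = 2 / pi * Re A"
  proof -
    have I: "((\<lambda>\<theta>. exp (\<i> * of_real t * of_real (cos \<theta>))) has_integral A) {0..pi/2}"
      unfolding A_def by (intro integrable_integral integrable_continuous_interval continuous_intros)
    have "integral {0..pi/2} (\<lambda>\<theta>. exp (\<i> * (- of_real t) * of_real (cos \<theta>))) = cnj A"
      unfolding A_def integral_cnj by (simp add: exp_cnj)
    then have "J0_complex (of_real t) = of_real (1 / pi) * (A + cnj A)"
      unfolding J0_complex_quarter A_def by simp
    then show ?thesis
      unfolding J0_complex_real complex_add_cnj by (simp add: complex_eq_iff)
  qed
  ultimately show ?thesis by simp
qed

section \<open>The algebraic identity behind the coefficients\<close>

text \<open>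
  The coefficients of the primitive of \<open>h ^ j * (2 * u - h) ^ j\<close> that vanishes at \<open>h = 0\<close>,
  after the power \<open>h ^ (j + 1)\<close> is split off.
\<close>

definition primitive_coeff :: "nat \<Rightarrow> nat \<Rightarrow> real" where
  "primitive_coeff j i = (-1) ^ i * real (j choose i) * 2 ^ (j - i) / real (j + 1 + i)"

lemma DERIV_primitive_polynomial:
  fixes u h :: "'a::real_normed_field"
  shows "((\<lambda>h. \<Sum>i\<le>j. of_real (primitive_coeff j i) * u ^ (j - i) * h ^ (j + 1 + i))
    has_field_derivative (h * (2 * u - h)) ^ j) (at h)"
proof -
  have "((\<lambda>h. \<Sum>i\<le>j. of_real (primitive_coeff j i) * u ^ (j - i) * h ^ (j + 1 + i)) has_field_derivative
     (\<Sum>i\<le>j. of_real (primitive_coeff j i) * u ^ (j - i) * (of_nat (j + 1 + i) * h ^ (j + i)))) (at h)"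
  proof (rule DERIV_sum)
    fix i
    have "((\<lambda>h. h ^ (j + 1 + i)) has_field_derivative of_nat (j + 1 + i) * h ^ (j + i)) (at h)"
      using DERIV_power[OF DERIV_ident, where n = "j + 1 + i"] by simp
    then show "((\<lambda>h. of_real (primitive_coeff j i) * u ^ (j - i) * h ^ (j + 1 + i)) has_field_derivative
       of_real (primitive_coeff j i) * u ^ (j - i) * (of_nat (j + 1 + i) * h ^ (j + i))) (at h)"
      by (rule DERIV_cmult)
  qed
  also have "(\<Sum>i\<le>j. of_real (primitive_coeff j i) * u ^ (j - i) * (of_nat (j + 1 + i) * h ^ (j + i)))
      = h ^ j * (\<Sum>i\<le>j. of_nat (j choose i) * (- h) ^ i * (2 * u) ^ (j - i))"
    unfolding sum_distrib_left
  proof (rule sum.cong)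
    fix i
    have "of_real (primitive_coeff j i) * of_nat (j + 1 + i) = of_real (primitive_coeff j i * real (j + 1 + i))"
      by (metis of_real_mult of_real_of_nat_eq)
    also have "primitive_coeff j i * real (j + 1 + i) = (-1) ^ i * real (j choose i) * 2 ^ (j - i)"
      by (simp add: primitive_coeff_def)
    finally have "of_real (primitive_coeff j i) * of_nat (j + 1 + i) = ((-1) ^ i * of_nat (j choose i) * 2 ^ (j - i) :: 'a)"
      by simp
    moreover have "of_real (primitive_coeff j i) * u ^ (j - i) * (of_nat (j + 1 + i) * h ^ (j + i)) =
        (of_real (primitive_coeff j i) * of_nat (j + 1 + i)) * (u ^ (j - i) * h ^ (j + i))"
      by (simp only: mult_ac)
    moreover have "(2 * u) ^ (j - i) = 2 ^ (j - i) * u ^ (j - i)" "h ^ (j + i) = h ^ j * h ^ i"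
      "(- h) ^ i = (-1) ^ i * h ^ i"
      by (simp_all only: power_mult_distrib power_add power_minus[of h])
    ultimately show "of_real (primitive_coeff j i) * u ^ (j - i) * (of_nat (j + 1 + i) * h ^ (j + i)) =
        h ^ j * (of_nat (j choose i) * (- h) ^ i * (2 * u) ^ (j - i))"
      by (simp only: mult_ac)
  qed simp
  also have "\<dots> = h ^ j * (- h + 2 * u) ^ j" by (simp only: binomial_ring)
  also have "\<dots> = (h * (2 * u - h)) ^ j" by (simp add: power_mult_distrib)
  finally show ?thesis .
qed

lemma sum_primitive_coeff_pos: "0 < (\<Sum>i\<le>j. primitive_coeff j i)"
proof -
  define P where "P = (\<lambda>x::real. \<Sum>i\<le>j. of_real (primitive_coeff j i) * 1 ^ (j - i) * x ^ (j + 1 + i))"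
  have D: "(P has_field_derivative (x * (2 * 1 - x)) ^ j) (at x)" for x
    unfolding P_def by (rule DERIV_primitive_polynomial)
  have "P 0 < P 1"
  proof (rule DERIV_pos_imp_increasing_open[where f = P])
    show "\<exists>y. (P has_real_derivative y) (at x) \<and> 0 < y" if "0 < x" "x < 1" for x
      using that by (intro exI[of _ "(x * (2 * 1 - x)) ^ j"] conjI D) auto
    show "continuous_on {0..1} P"
      by (meson D DERIV_isCont continuous_at_imp_continuous_on)
  qed simp
  then show ?thesis by (simp add: P_def)
qed

definition rotation_coeff :: "nat \<Rightarrow> nat \<Rightarrow> real" where
  "rotation_coeff j i = primitive_coeff j i / (\<Sum>i\<le>j. primitive_coeff j i)"

lemma rotation_coeff_in_Rats: "rotation_coeff j i \<in> \<rat>"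
proof -
  have "primitive_coeff j i \<in> \<rat>" for i
    unfolding primitive_coeff_def by (intro Rats_divide Rats_mult Rats_power) auto
  then show ?thesis unfolding rotation_coeff_def by (intro Rats_divide Rats_sum)
qed

text \<open>
  Move \<open>h\<close> along the vertical line \<open>Re h = u\<close>. There \<open>h * (2 * u - h) = h * cnj h\<close> is real,
  so the primitive of its \<open>j\<close>-th power changes by a purely imaginary amount, and its real part
  keeps the value that it has at \<open>h = u\<close>. The exponents of \<open>h\<close> on the right all exceed the
  exponents of \<open>u\<close>, which is what makes the contour rotation possible when \<open>u\<close> is \<open>J\<^sub>0\<close> and
  \<open>h\<close> is the Hankel function.
\<close>

lemma power_eq_Re_rotation_sum:
  "Re h ^ (2 * j + 1) = Re (\<Sum>i\<le>j. of_real (rotation_coeff j i) * of_real (Re h) ^ (j - i) * h ^ (j + 1 + i))"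
proof -
  define u where "u = Re h"
  define S where "S = (\<Sum>i\<le>j. primitive_coeff j i)"
  define Q where "Q = (\<lambda>h. \<Sum>i\<le>j. of_real (primitive_coeff j i) * of_real u ^ (j - i) * h ^ (j + 1 + i) :: complex)"
  have D: "(Q has_field_derivative (h * (2 * of_real u - h)) ^ j) (at h)" for h
    unfolding Q_def by (rule DERIV_primitive_polynomial)
  have "((\<lambda>v. Re (Q (of_real u + of_real v * \<i>))) has_real_derivative 0) (at v)" for v
  proof -
    have "((\<lambda>v. of_real u + of_real v * \<i>) has_vector_derivative \<i>) (at v)"
      by (auto intro!: derivative_eq_intros)
    from field_vector_diff_chain_at[OF this D]
    have "((\<lambda>v. Q (of_real u + of_real v * \<i>)) has_vector_derivative
       \<i> * ((of_real u + of_real v * \<i>) * (2 * of_real u - (of_real u + of_real v * \<i>))) ^ j) (at v)"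
      by (simp add: o_def)
    moreover have "(of_real u + of_real v * \<i>) * (2 * of_real u - (of_real u + of_real v * \<i>)) = of_real (u\<^sup>2 + v\<^sup>2)"
      by (simp add: complex_eq_iff power2_eq_square algebra_simps)
    ultimately have "((\<lambda>v. Q (of_real u + of_real v * \<i>)) has_vector_derivative \<i> * of_real ((u\<^sup>2 + v\<^sup>2) ^ j)) (at v)"
      by simp
    from bounded_linear.has_vector_derivative[OF bounded_linear_Re this] show ?thesis
      by (simp add: has_real_derivative_iff_has_vector_derivative)
  qed
  then have "Re (Q (of_real u + of_real (Im h) * \<i>)) = Re (Q (of_real u + of_real 0 * \<i>))"
    by (intro DERIV_isconst_all allI)
  moreover have "of_real u + of_real (Im h) * \<i> = h" by (simp add: u_def complex_eq_iff)
  moreover have "Q (of_real u + of_real 0 * \<i>) = of_real (S * u ^ (2 * j + 1))"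
  proof -
    have "Q (of_real u + of_real 0 * \<i>) = of_real (\<Sum>i\<le>j. primitive_coeff j i * (u ^ (j - i) * u ^ (j + 1 + i)))"
      by (simp add: Q_def mult.assoc)
    also have "(\<Sum>i\<le>j. primitive_coeff j i * (u ^ (j - i) * u ^ (j + 1 + i))) = (\<Sum>i\<le>j. primitive_coeff j i * u ^ (2 * j + 1))"
      by (intro sum.cong refl) (simp only: power_add[symmetric], simp add: mult_2 add_ac)
    finally show ?thesis by (simp add: S_def sum_distrib_right)
  qed
  ultimately have "Re (Q h) = S * u ^ (2 * j + 1)" by simp
  moreover have "S \<noteq> 0" using sum_primitive_coeff_pos[of j] by (simp add: S_def)
  moreover have "(\<Sum>i\<le>j. of_real (rotation_coeff j i) * of_real u ^ (j - i) * h ^ (j + 1 + i)) = Q h / of_real S"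
    unfolding Q_def rotation_coeff_def S_def[symmetric] sum_divide_distrib by simp
  ultimately show ?thesis by (simp add: u_def[symmetric])
qed

section \<open>The Hankel function\<close>

text \<open>
  The Hankel function \<open>H\<close> of the first kind of order 0, that is \<open>2 / (\<pi> \<i>) * K\<^sub>0(- \<i> z)\<close>.
\<close>

definition hankel1 :: "complex \<Rightarrow> complex" where
  "hankel1 z = - (2 / of_real pi) * \<i> * K0_upper z"

lemma continuous_on_hankel1: "continuous_on {z. 0 \<le> Im z \<and> z \<noteq> 0} hankel1"
  unfolding hankel1_def by (intro continuous_intros continuous_on_K0_upper)

lemma holomorphic_hankel1: "hankel1 holomorphic_on {z. Im z > 0}"
  unfolding hankel1_def by (intro holomorphic_intros holomorphic_K0_upper)

lemma Re_hankel1_real: "t > 0 \<Longrightarrow> Re (hankel1 (of_real t)) = bessel_J0 t"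
  using Im_K0_upper_real[of t] by (simp add: hankel1_def field_simps)

lemma hankel1_imaginary: "y > 0 \<Longrightarrow> hankel1 (\<i> * of_real y) = - (2 / of_real pi) * \<i> * of_real (bessel_K0 y)"
  using K0_upper_imaginary(1)[of y] by (simp add: hankel1_def)

lemma norm_hankel1_le_norm_K0_upper: "norm (hankel1 z) \<le> norm (K0_upper z)"
proof -
  have "norm (hankel1 z) = 2 / pi * norm (K0_upper z)" by (simp add: hankel1_def norm_mult norm_divide)
  also have "\<dots> \<le> 1 * norm (K0_upper z)" using pi_gt3 by (intro mult_right_mono) (auto simp: field_simps)
  finally show ?thesis by simp
qed

lemma sinh_ge_power:
  fixes x :: real
  assumes "0 \<le> x" "odd N"
  shows "x ^ N / fact N \<le> sinh x"
proof -
  let ?f = "\<lambda>n. if even n then 0 else x ^ n /\<^sub>R fact n"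
  have "sum ?f {N} \<le> suminf ?f"
    using sinh_converges[of x] assms by (intro sum_le_suminf) (auto simp: sums_iff)
  then show ?thesis using sinh_converges[of x] assms by (simp add: sums_iff field_simps)
qed

lemma norm_hankel1_le:
  assumes "Im z \<ge> 0" "z \<noteq> 0"
  shows "norm (hankel1 z) \<le> 3 * exp (- Im z) / sqrt (norm z)"
proof -
  define \<delta> where "\<delta> = 1 / sqrt (norm z)"
  have "\<delta> > 0" using assms by (simp add: \<delta>_def)
  have *: "norm z * \<delta> = 1 / \<delta>" using assms by (simp add: \<delta>_def real_div_sqrt)
  have "\<delta> \<le> sinh \<delta>" using sinh_ge_power[of \<delta> 1] \<open>\<delta> > 0\<close> by simp
  have "norm (hankel1 z) \<le> exp (- Im z) * (\<delta> + 2 / (norm z * sinh \<delta>))"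
    using norm_hankel1_le_norm_K0_upper norm_K0_upper_le[OF assms \<open>\<delta> > 0\<close>] by (rule order_trans)
  also have "\<dots> \<le> exp (- Im z) * (\<delta> + 2 / (norm z * \<delta>))"
    using \<open>\<delta> \<le> sinh \<delta>\<close> \<open>\<delta> > 0\<close> assms
    by (intro mult_left_mono add_left_mono divide_left_mono mult_pos_pos) auto
  also have "\<dots> = 3 * exp (- Im z) / sqrt (norm z)"
    unfolding * by (simp add: \<delta>_def)
  finally show ?thesis .
qed

text \<open>
  The logarithmic singularity at 0 is weaker than any negative power of \<open>norm z\<close>, so that
  even after multiplication by \<open>z\<close> any power of \<open>H\<close> tends to 0 there.
\<close>

lemma norm_hankel1_power_le:
  assumes "b > 0"
  obtains C where "\<And>z. Im z \<ge> 0 \<Longrightarrow> z \<noteq> 0 \<Longrightarrow> norm (hankel1 z ^ b) \<le> C / sqrt (norm z)"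
proof
  fix z :: complex assume z: "Im z \<ge> 0" "z \<noteq> 0"
  define N where "N = 2 * b - 1"
  have N: "odd N" "Suc N = 2 * b" using assms by (auto simp: N_def)
  \<comment> \<open>With this \<open>d\<close>, \<open>norm z * sinh d\<close> is at least of order \<open>norm z * d ^ (2 * b - 1) = 1 / d\<close>, so \<open>K0_upper z\<close> is at most of order \<open>d\<close>.\<close>
  define d where "d = root (2 * b) (1 / norm z)"
  have d: "d > 0" "d ^ (2 * b) = 1 / norm z"
    using assms z by (auto simp: d_def real_root_pow_pos2)
  have db: "d ^ b = 1 / sqrt (norm z)"
  proof -
    have "(d ^ b)\<^sup>2 = 1 / norm z" using d by (simp add: power_mult[symmetric] mult.commute)
    then have "d ^ b = sqrt (1 / norm z)" using d by (metis real_sqrt_unique zero_less_power less_imp_le)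
    then show ?thesis by (simp add: real_sqrt_divide)
  qed
  have dN: "norm z * d ^ N = 1 / d"
  proof -
    have "d * d ^ N = 1 / norm z" using d N by (metis power_Suc)
    then show ?thesis using d z by (simp add: field_simps)
  qed
  have sN: "d ^ N / fact N \<le> sinh d" using sinh_ge_power[of d N] d N by simp
  have "norm (hankel1 z) \<le> exp (- Im z) * (d + 2 / (norm z * sinh d))"
    using norm_hankel1_le_norm_K0_upper norm_K0_upper_le[OF z d(1)] by (rule order_trans)
  also have "\<dots> \<le> 1 * (d + 2 / (norm z * (d ^ N / fact N)))"
    using sN d z by (intro mult_mono add_mono divide_left_mono mult_left_mono mult_pos_pos) auto
  also have "\<dots> = (1 + 2 * fact N) * d"
    using dN by (simp add: algebra_simps)
  finally have "norm (hankel1 z ^ b) \<le> ((1 + 2 * fact N) * d) ^ b"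
    unfolding norm_power by (intro power_mono) auto
  also have "\<dots> = (1 + 2 * fact N) ^ b / sqrt (norm z)"
    by (simp add: power_mult_distrib db)
  finally show "norm (hankel1 z ^ b) \<le> (1 + 2 * fact (2 * b - 1)) ^ b / sqrt (norm z)"
    by (simp add: N_def)
qed

section \<open>Rotating the contour\<close>

text \<open>
  For \<open>z = t > 0\<close> its factors are those of Kluyver's integrand with \<open>b\<close> copies of \<open>J\<^sub>0\<close>
  replaced by \<open>H\<close>; for \<open>z = \<i> y\<close> it is, up to a constant, the integrand with \<open>b\<close> copies of
  \<open>K\<^sub>0\<close>. The factor \<open>z\<close> gives it the value 0 at 0, whatever \<open>hankel1 0\<close> is, and this value
  extends it continuously.
\<close>

definition bessel_product :: "real \<Rightarrow> nat \<Rightarrow> nat \<Rightarrow> complex \<Rightarrow> complex" where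
  "bessel_product x a b z = of_real x * z * J0_complex (of_real x * z) * J0_complex z ^ a * hankel1 z ^ b"

lemma continuous_on_J0_complex [continuous_intros]:
  "continuous_on S f \<Longrightarrow> continuous_on S (\<lambda>z. J0_complex (f z))"
  using continuous_on_compose2[OF holomorphic_on_imp_continuous_on[OF holomorphic_J0_complex[of UNIV]]] by blast

lemma continuous_on_bessel_product:
  assumes "b > 0"
  shows "continuous_on {z. 0 \<le> Im z} (bessel_product x a b)"
  unfolding continuous_on_eq_continuous_within
proof
  fix z :: complex assume "z \<in> {z. 0 \<le> Im z}"
  then have z: "0 \<le> Im z" by simp
  show "continuous (at z within {z. 0 \<le> Im z}) (bessel_product x a b)"
  proof (cases "z = 0")
    case False
    have "continuous_on {z. 0 \<le> Im z \<and> z \<noteq> 0} (bessel_product x a b)"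
      unfolding bessel_product_def by (intro continuous_intros continuous_on_hankel1)
    then have "continuous (at z within {z. 0 \<le> Im z \<and> z \<noteq> 0}) (bessel_product x a b)"
      using False z by (simp add: continuous_on_eq_continuous_within)
    moreover have "at z within {z. 0 \<le> Im z \<and> z \<noteq> 0} = at z within {z. 0 \<le> Im z}"
      by (rule at_within_nhd[of _ "- {0}"]) (use False in auto)
    ultimately show ?thesis by simp
  next
    case True
    obtain C where C: "\<And>z. Im z \<ge> 0 \<Longrightarrow> z \<noteq> 0 \<Longrightarrow> norm (hankel1 z ^ b) \<le> C / sqrt (norm z)"
      using norm_hankel1_power_le[OF assms] by metis
    define P where "P = (\<lambda>z. of_real x * J0_complex (of_real x * z) * J0_complex z ^ a)"
    have "continuous_on UNIV P" unfolding P_def by (intro continuous_intros)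
    then have "isCont P 0" by (simp add: continuous_on_eq_continuous_at)
    then have "((\<lambda>z. norm (P z) * (C * sqrt (norm z))) \<longlongrightarrow> norm (P 0) * (C * sqrt (norm (0::complex)))) (at 0)"
      unfolding isCont_def by (intro tendsto_intros)
    then have lim: "((\<lambda>z. norm (P z) * (C * sqrt (norm z))) \<longlongrightarrow> 0) (at 0 within {z. 0 \<le> Im z})"
      by (auto intro: tendsto_within_subset)
    have "(bessel_product x a b \<longlongrightarrow> 0) (at 0 within {z. 0 \<le> Im z})"
    proof (rule Lim_null_comparison[OF _ lim])
      have "norm (bessel_product x a b z) \<le> norm (P z) * (C * sqrt (norm z))" if "0 \<le> Im z" "z \<noteq> 0" for z
      proof -
        have "norm (bessel_product x a b z) = norm (P z) * (norm z * norm (hankel1 z ^ b))"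
          by (simp add: bessel_product_def P_def norm_mult mult_ac)
        also have "\<dots> \<le> norm (P z) * (norm z * (C / sqrt (norm z)))"
          by (intro mult_left_mono C that) auto
        also have "norm z * (C / sqrt (norm z)) = C * sqrt (norm z)"
          using real_div_sqrt[of "norm z"] by (metis mult.commute norm_ge_zero times_divide_eq_right)
        finally show ?thesis .
      qed
      then show "\<forall>\<^sub>F z in at 0 within {z. 0 \<le> Im z}. norm (bessel_product x a b z) \<le> norm (P z) * (C * sqrt (norm z))"
        by (auto simp: eventually_at_filter)
    qed
    then show ?thesis by (simp add: True continuous_within bessel_product_def)
  qed
qed

text \<open>
  The \<open>a + b + 1\<close> factors contribute \<open>1 / sqrt (norm z)\<close> each, and the exponential growth of
  \<open>J\<^sub>0\<close> is beaten by the decay of \<open>H\<close> if \<open>a + x \<le> b\<close>.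
\<close>

lemma norm_bessel_product_le:
  assumes "0 < x" and "a + b = 2 * j + 1" and "Im z \<ge> 0" "z \<noteq> 0"
  shows "norm (bessel_product x a b z)
    \<le> (4 * sqrt x * 4 ^ a * 3 ^ b) * exp (- (real b - real a - x) * Im z) / norm z ^ j"
proof -
  let ?s = "sqrt (norm z)" and ?y = "Im z"
  have s: "?s > 0" "norm z = ?s\<^sup>2" using assms by auto
  have "norm (bessel_product x a b z) = x * norm z * norm (J0_complex (of_real x * z)) * norm (J0_complex z) ^ a * norm (hankel1 z) ^ b"
    using assms by (simp add: bessel_product_def norm_mult norm_power)
  also have "\<dots> \<le> x * norm z * (4 * exp (x * ?y) / sqrt (x * norm z)) * (4 * exp ?y / ?s) ^ a * (3 * exp (- ?y) / ?s) ^ b"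
    using norm_J0_complex_le[of "of_real x * z"] norm_J0_complex_le[of z] norm_hankel1_le[of z] assms
    by (intro mult_mono power_mono) (auto simp: norm_mult abs_mult)
  also have "\<dots> = (x * norm z / sqrt (x * norm z)) * (4 * 4 ^ a * 3 ^ b)
       * (exp (x * ?y) * exp ?y ^ a * exp (- ?y) ^ b) / (?s ^ a * ?s ^ b)"
    by (simp add: power_mult_distrib power_divide field_simps)
  also have "x * norm z / sqrt (x * norm z) = sqrt x * ?s"
    using assms real_div_sqrt[of "x * norm z"] by (simp add: real_sqrt_mult)
  also have "exp (x * ?y) * exp ?y ^ a * exp (- ?y) ^ b = exp (- (real b - real a - x) * ?y)"
    by (simp add: exp_of_nat_mult[symmetric] exp_add[symmetric] algebra_simps)
  also have "?s ^ a * ?s ^ b = ?s * norm z ^ j"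
    unfolding power_add[symmetric] assms(2) using s by (simp add: power_mult)
  also have "sqrt x * ?s * (4 * 4 ^ a * 3 ^ b) * exp (- (real b - real a - x) * ?y) / (?s * norm z ^ j) = 
    (4 * sqrt x * 4 ^ a * 3 ^ b) * exp (- (real b - real a - x) * Im z) / norm z ^ j"
    using s(1) by (simp add: field_simps)
  finally show ?thesis .
qed

lemma bessel_product_primitive:
  assumes "b > 0"
  obtains F where "\<And>z. 0 \<le> Im z \<Longrightarrow> (F has_field_derivative bessel_product x a b z) (at z within {z. 0 \<le> Im z})"
proof (rule holomorphic_convex_primitive[of "{z. 0 \<le> Im z}" "{}" "bessel_product x a b"])
  show "convex {z. 0 \<le> Im z}" using convex_halfspace_Im_ge[of 0] by simp
  show "continuous_on {z. 0 \<le> Im z} (bessel_product x a b)"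
    by (rule continuous_on_bessel_product[OF assms])
  fix z assume "z \<in> interior {z. 0 \<le> Im z} - {}"
  then obtain e where e: "e > 0" "ball z e \<subseteq> {z. 0 \<le> Im z}" by (auto simp: mem_interior)
  have "z - \<i> * of_real (e / 2) \<in> ball z e" using e(1) by (simp add: dist_norm norm_mult)
  with e(2) have "z - \<i> * of_real (e / 2) \<in> {z. 0 \<le> Im z}" by (rule subsetD)
  with e(1) have "Im z > 0" by simp
  have "bessel_product x a b holomorphic_on {z. Im z > 0}"
    unfolding bessel_product_def
    by (intro holomorphic_intros holomorphic_hankel1 holomorphic_J0_complex
        holomorphic_on_compose_gen[OF _ holomorphic_J0_complex[of UNIV], unfolded o_def]) auto
  then show "bessel_product x a b field_differentiable at z"
    using \<open>Im z > 0\<close> open_halfspace_Im_gt[of 0] holomorphic_on_imp_differentiable_at by auto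
qed (use that in auto)

lemma integral_exp_minus_le:
  fixes c T :: real
  assumes "c > 0"
  shows "integral {0..T} (\<lambda>s. exp (- c * s)) \<le> 1 / c"
proof (cases "T \<ge> 0")
  case True
  have "((\<lambda>s. exp (- c * s)) has_integral (- exp (- c * T) / c - (- exp (- c * 0) / c))) {0..T}"
    by (intro fundamental_theorem_of_calculus)
      (use assms True in \<open>auto intro!: derivative_eq_intros simp: has_real_derivative_iff_has_vector_derivative[symmetric]\<close>)
  from integral_unique[OF this] show ?thesis using assms by (simp only:) (simp add: divide_simps)
qed (use assms in auto)

text \<open>
  With a primitive \<open>F\<close> on the closed half-plane, the difference equals \<open>F T - F (\<i> T)\<close>, which
  is expressed through the two sides of the square that meet in \<open>T + \<i> T\<close>. On the vertical
  side the integrand is at most a constant times \<open>exp (- c s) / T ^ j\<close>, on the horizontal side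
  at most a constant times \<open>exp (- c T) / T ^ j\<close>. For \<open>c = 0\<close> the length of the sides costs
  one power of \<open>T\<close>, which is why \<open>j \<ge> 2\<close> is required in that case; for \<open>c > 0\<close>, \<open>j \<ge> 1\<close>
  suffices.
\<close>

lemma bessel_product_rotation:
  assumes "0 < x" "b > 0" "a + b = 2 * j + 1" and c: "0 \<le> real b - real a - x"
    and j: "j \<ge> 2 \<or> (j \<ge> 1 \<and> 0 < real b - real a - x)"
  shows "((\<lambda>T. integral {0..T} (\<lambda>t. bessel_product x a b (of_real t))
     - integral {0..T} (\<lambda>y. \<i> * bessel_product x a b (\<i> * of_real y))) \<longlongrightarrow> 0) at_top"
proof -
  let ?G = "bessel_product x a b"
  define c where "c = real b - real a - x"
  define B where "B = 4 * sqrt x * 4 ^ a * 3 ^ b"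
  have "c \<ge> 0" "B \<ge> 0" using assms by (auto simp: c_def B_def)
  obtain F where F: "\<And>z. z \<in> {z. 0 \<le> Im z} \<Longrightarrow> (F has_field_derivative ?G z) (at z within {z. 0 \<le> Im z})"
    using bessel_product_primitive[OF \<open>b > 0\<close>] by auto
  note line = has_integral_primitive_along_line[where S = "{z. 0 \<le> Im z}" and F = F and g = ?G, OF F]
  define D where "D = (\<lambda>T. integral {0..T} (\<lambda>t. ?G (of_real t)) - integral {0..T} (\<lambda>y. \<i> * ?G (\<i> * of_real y)))"
  \<comment> \<open>Bounds both the integral of \<open>exp (- c * s)\<close> over \<open>{0..T}\<close> and \<open>T * exp (- c * T)\<close>.\<close>
  define M where "M = (\<lambda>T. if c > 0 then 1 / c else T)"
  have bound: "norm (D T) \<le> 2 * B * M T / T ^ j" if "T > 0" for T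
  proof -
    have G_le: "norm (?G z) \<le> B / T ^ j * exp (- c * Im z)" if "0 \<le> Im z" "T \<le> norm z" for z
    proof -
      have "norm (?G z) \<le> B * exp (- c * Im z) / norm z ^ j"
        unfolding B_def c_def using that \<open>T > 0\<close> assms by (intro norm_bessel_product_le) auto
      also have "\<dots> \<le> B * exp (- c * Im z) / T ^ j"
        using that \<open>T > 0\<close> \<open>B \<ge> 0\<close> by (intro divide_left_mono power_mono mult_nonneg_nonneg mult_pos_pos zero_less_power) auto
      finally show ?thesis by simp
    qed
    have MT: "integral {0..T} (\<lambda>s. exp (- c * s)) \<le> M T" "T * exp (- c * T) \<le> M T"
    proof -
      show "integral {0..T} (\<lambda>s. exp (- c * s)) \<le> M T"
        using integral_exp_minus_le[of c T] \<open>c \<ge> 0\<close> \<open>T > 0\<close> by (auto simp: M_def)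
      show "T * exp (- c * T) \<le> M T"
      proof (cases "c > 0")
        case True
        have "c * T \<le> exp (c * T)" using exp_ge_add_one_self[of "c * T"] by linarith
        then show ?thesis using True by (simp add: M_def exp_minus field_simps)
      qed (use \<open>c \<ge> 0\<close> in \<open>auto simp: M_def\<close>)
    qed
    have I1: "((\<lambda>s. \<i> * ?G (of_real T + of_real s * \<i>)) has_integral F (of_real T + of_real T * \<i>) - F (of_real T + of_real 0 * \<i>)) {0..T}"
      using \<open>T > 0\<close> by (intro line) auto
    have I2: "((\<lambda>s. 1 * ?G (of_real T * \<i> + of_real s * 1)) has_integral F (of_real T * \<i> + of_real T * 1) - F (of_real T * \<i> + of_real 0 * 1)) {0..T}"
      using \<open>T > 0\<close> by (intro line) auto
    have I3: "((\<lambda>s. 1 * ?G (0 + of_real s * 1)) has_integral F (0 + of_real T * 1) - F (0 + of_real 0 * 1)) {0..T}"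
      using \<open>T > 0\<close> by (intro line) auto
    have I4: "((\<lambda>s. \<i> * ?G (0 + of_real s * \<i>)) has_integral F (0 + of_real T * \<i>) - F (0 + of_real 0 * \<i>)) {0..T}"
      using \<open>T > 0\<close> by (intro line) auto
    have n1: "norm (F (of_real T + of_real T * \<i>) - F (of_real T + of_real 0 * \<i>)) \<le> B / T ^ j * M T"
    proof -
      have "norm (F (of_real T + of_real T * \<i>) - F (of_real T + of_real 0 * \<i>)) \<le> integral {0..T} (\<lambda>s. B / T ^ j * exp (- c * s))"
        unfolding integral_unique[OF I1, symmetric]
      proof (rule integral_norm_bound_integral)
        show "(\<lambda>s. \<i> * ?G (of_real T + of_real s * \<i>)) integrable_on {0..T}" using I1 by (rule has_integral_integrable)
        show "(\<lambda>s. B / T ^ j * exp (- c * s)) integrable_on {0..T}"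
          by (intro integrable_continuous_interval continuous_intros)
        fix s assume s: "s \<in> {0..T}"
        have "T \<le> norm (of_real T + of_real s * \<i>)"
          using abs_Re_le_cmod[of "of_real T + of_real s * \<i>"] by simp
        from G_le[OF _ this] s show "norm (\<i> * ?G (of_real T + of_real s * \<i>)) \<le> B / T ^ j * exp (- c * s)"
          by (simp add: norm_mult)
      qed
      also have "\<dots> = B / T ^ j * integral {0..T} (\<lambda>s. exp (- c * s))" by (rule integral_mult_right)
      also have "\<dots> \<le> B / T ^ j * M T" using \<open>B \<ge> 0\<close> \<open>T > 0\<close> by (intro mult_left_mono MT) auto
      finally show ?thesis .
    qed
    have n2: "norm (F (of_real T * \<i> + of_real T * 1) - F (of_real T * \<i> + of_real 0 * 1)) \<le> B / T ^ j * M T"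
    proof -
      have "norm (integral {0..T} (\<lambda>s. 1 * ?G (of_real T * \<i> + of_real s * 1))) \<le> integral {0..T} (\<lambda>s. B / T ^ j * exp (- c * T))"
      proof (rule integral_norm_bound_integral)
        show "(\<lambda>s. 1 * ?G (of_real T * \<i> + of_real s * 1)) integrable_on {0..T}" using I2 by (rule has_integral_integrable)
        show "(\<lambda>s. B / T ^ j * exp (- c * T)) integrable_on {0..T}"
          by (intro integrable_continuous_interval continuous_intros)
        fix s assume s: "s \<in> {0..T}"
        have "T \<le> norm (of_real T * \<i> + of_real s * 1)"
          using abs_Im_le_cmod[of "of_real T * \<i> + of_real s * 1"] by simp
        from G_le[OF _ this] \<open>T > 0\<close> show "norm (1 * ?G (of_real T * \<i> + of_real s * 1)) \<le> B / T ^ j * exp (- c * T)"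
          by simp
      qed
      also have "\<dots> = B / T ^ j * (T * exp (- c * T))" using \<open>T > 0\<close> by simp
      also have "\<dots> \<le> B / T ^ j * M T" using \<open>B \<ge> 0\<close> \<open>T > 0\<close> by (intro mult_left_mono MT) auto
      finally show ?thesis unfolding integral_unique[OF I2] .
    qed
    have "D T = (F (of_real T * \<i> + of_real T * 1) - F (of_real T * \<i> + of_real 0 * 1))
        - (F (of_real T + of_real T * \<i>) - F (of_real T + of_real 0 * \<i>))"
      using integral_unique[OF I3] integral_unique[OF I4] by (simp add: D_def mult.commute add.commute)
    then have "norm (D T) \<le> B / T ^ j * M T + B / T ^ j * M T"
      using order_trans[OF norm_triangle_ineq4 add_mono[OF n2 n1]] by (simp only:)
    then show ?thesis by simp
  qed
  have "((\<lambda>T. 2 * B * M T / T ^ j) \<longlongrightarrow> 0) at_top"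
  proof (cases "c > 0")
    case True
    then have "j \<ge> 1" using j by auto
    then have "filterlim (\<lambda>T::real. T ^ j) at_top at_top"
      by (intro filterlim_pow_at_top filterlim_ident) auto
    then have "((\<lambda>T. 2 * B * (1 / c) / T ^ j) \<longlongrightarrow> 0) at_top"
      by (intro tendsto_divide_0[OF tendsto_const] filterlim_at_top_imp_at_infinity)
    then show ?thesis using True by (simp only: M_def if_True)
  next
    case False
    then obtain k where k: "j = Suc k" "k > 0" using j by (cases j) (auto simp: c_def)
    then have "filterlim (\<lambda>T::real. T ^ k) at_top at_top"
      by (intro filterlim_pow_at_top filterlim_ident) auto
    then have "((\<lambda>T. 2 * B / T ^ k) \<longlongrightarrow> 0) at_top"
      by (intro tendsto_divide_0[OF tendsto_const] filterlim_at_top_imp_at_infinity)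
    moreover have "\<forall>\<^sub>F T in at_top. 2 * B / T ^ k = 2 * B * M T / T ^ j"
      using eventually_gt_at_top[of 0] by eventually_elim (use False k in \<open>simp add: M_def\<close>)
    ultimately show ?thesis by (rule Lim_transform_eventually)
  qed
  moreover have "\<forall>\<^sub>F T in at_top. norm (D T) \<le> 2 * B * M T / T ^ j"
    using eventually_gt_at_top[of 0] by eventually_elim (rule bound)
  ultimately have "(D \<longlongrightarrow> 0) at_top" by (rule Lim_null_comparison[rotated])
  then show ?thesis unfolding D_def .
qed

lemma continuous_dominated_integrable_atLeast:
  fixes f :: "real \<Rightarrow> 'a::euclidean_space"
  assumes "continuous_on {0..} f" "h integrable_on {1..}" "\<And>y. y \<ge> 1 \<Longrightarrow> norm (f y) \<le> h y"
  shows "f integrable_on {0..}"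
proof (rule integrable_Un')
  show "f integrable_on {0..1}"
    by (rule integrable_continuous_interval[OF continuous_on_subset[OF assms(1)]]) auto
  show "f integrable_on {1..}"
  proof (rule measurable_bounded_by_integrable_imp_integrable)
    show "f \<in> borel_measurable (lebesgue_on {1..})"
      by (rule continuous_imp_measurable_on_sets_lebesgue[OF continuous_on_subset[OF assms(1)]]) auto
  qed (use assms in auto)
  have "{0..1} \<inter> {1..} = {1::real}" by auto
  then show "negligible ({0..1} \<inter> {1::real..})" by simp
qed auto

lemma bessel_product_imaginary_integrable:
  assumes "0 < x" "b > 0" "a + b = 2 * j + 1" and c: "0 \<le> real b - real a - x"
    and j: "j \<ge> 2 \<or> (j \<ge> 1 \<and> 0 < real b - real a - x)"
  shows "(\<lambda>y. \<i> * bessel_product x a b (\<i> * of_real y)) integrable_on {0..}"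
proof -
  define c where "c = real b - real a - x"
  define B where "B = 4 * sqrt x * 4 ^ a * 3 ^ b"
  have "c \<ge> 0" "B \<ge> 0" using assms by (auto simp: c_def B_def)
  have cont: "continuous_on {0..} (\<lambda>y. \<i> * bessel_product x a b (\<i> * of_real y))"
    by (intro continuous_intros continuous_on_compose2[OF continuous_on_bessel_product[OF \<open>b > 0\<close>]]) auto
  have le: "norm (\<i> * bessel_product x a b (\<i> * of_real y)) \<le> B * exp (- c * y) / y ^ j" if "y \<ge> 1" for y
    using norm_bessel_product_le[OF assms(1,3), of "\<i> * of_real y"] that by (simp add: norm_mult B_def c_def)
  show ?thesis
  proof (cases "c > 0")
    case True
    show ?thesis
    proof (rule continuous_dominated_integrable_atLeast[OF cont, where h = "\<lambda>y. B * exp (- c * y)"])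
      show "(\<lambda>y. B * exp (- c * y)) integrable_on {1..}"
        using integrable_on_exp_minus_to_infinity[OF True] by (rule integrable_on_mult_right)
      fix y :: real assume y: "y \<ge> 1"
      have "B * exp (- c * y) / y ^ j \<le> B * exp (- c * y) / 1"
        using y \<open>B \<ge> 0\<close> by (intro divide_left_mono one_le_power) auto
      with le[OF y] show "norm (\<i> * bessel_product x a b (\<i> * of_real y)) \<le> B * exp (- c * y)" by simp
    qed
  next
    case False
    then have "j \<ge> 2" "c = 0" using j \<open>c \<ge> 0\<close> by (auto simp: c_def)
    show ?thesis
    proof (rule continuous_dominated_integrable_atLeast[OF cont, where h = "\<lambda>y. B * (1 / y ^ j)"])
      show "(\<lambda>y. B * (1 / y ^ j)) integrable_on {1..}"
        using has_integral_inverse_power_to_inf[of j 1] \<open>j \<ge> 2\<close>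
        by (intro integrable_on_mult_right) (auto simp: integrable_on_def)
      show "norm (\<i> * bessel_product x a b (\<i> * of_real y)) \<le> B * (1 / y ^ j)" if "y \<ge> 1" for y
        using le[OF that] \<open>c = 0\<close> by simp
    qed
  qed
qed

lemma bessel_product_imaginary:
  assumes "y \<ge> 0"
  shows "\<i> * bessel_product x a b (\<i> * of_real y) = - ((- \<i>) ^ b) *
    of_real (2 ^ b * (bessel_I0 (x * y) * bessel_I0 y ^ a * (bessel_K0 y / pi) ^ b * x * y))"
proof (cases "y = 0")
  case False
  then have h: "hankel1 (\<i> * of_real y) = (- \<i>) * of_real (2 * (bessel_K0 y / pi))"
    using hankel1_imaginary[of y] assms by simp
  have J: "J0_complex (of_real x * (\<i> * of_real y)) = of_real (bessel_I0 (x * y))"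
    using J0_complex_imaginary[of "x * y"] by (simp add: mult_ac)
  have "\<i> * bessel_product x a b (\<i> * of_real y) = (\<i> * \<i>) * (- \<i>) ^ b *
     of_real (x * y * bessel_I0 (x * y) * bessel_I0 y ^ a * (2 ^ b * (bessel_K0 y / pi) ^ b))"
    unfolding bessel_product_def h J J0_complex_imaginary
    by (simp only: power_mult_distrib of_real_mult of_real_power of_real_numeral mult_ac)
  then show ?thesis by (simp add: mult_ac)
qed (simp add: bessel_product_def)

text \<open>
  For odd \<open>b\<close> the constant \<open>(- \<i>) ^ b\<close> is imaginary. This is how half of the terms of the
  algebraic identity drop out, leaving only even powers of \<open>K\<^sub>0\<close>.
\<close>

lemma Re_bessel_product_imaginary_odd:
  assumes "y \<ge> 0" "odd b"
  shows "Re (\<i> * bessel_product x a b (\<i> * of_real y)) = 0"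
proof -
  obtain r where r: "b = 2 * r + 1" using assms by (auto elim: oddE)
  have "(- \<i>) ^ b = of_real ((-1) ^ r) * (- \<i>)" unfolding r by (simp add: power_mult)
  then show ?thesis unfolding bessel_product_imaginary[OF assms(1)] by simp
qed

lemma Re_bessel_product_imaginary_even:
  assumes "y \<ge> 0"
  shows "Re (\<i> * bessel_product x a (2 * r) (\<i> * of_real y)) = (-1) ^ (r + 1) * 2 ^ (2 * r) *
    (bessel_I0 (x * y) * bessel_I0 y ^ a * (bessel_K0 y / pi) ^ (2 * r) * x * y)"
proof -
  have "- ((- \<i>) ^ (2 * r)) = of_real ((-1) ^ (r + 1))" by (simp add: power_mult)
  then show ?thesis unfolding bessel_product_imaginary[OF assms] by (simp only: of_real_mult[symmetric] Re_complex_of_real mult.assoc)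
qed

section \<open>Existence of the representation\<close>

lemma bessel_J0_eq_Re: "bessel_J0 t = Re (J0_complex (of_real t))"
  by (simp add: J0_complex_real)

lemma kluyver_integrand_eq:
  assumes "t \<ge> 0"
  shows "bessel_J0 (x * t) * bessel_J0 t ^ (2 * j + 1) * x * t =
    Re (\<Sum>i\<le>j. of_real (rotation_coeff j i) * bessel_product x (j - i) (j + 1 + i) (of_real t))"
proof (cases "t = 0")
  case False
  let ?h = "hankel1 (of_real t)"
  have Re: "Re ?h = bessel_J0 t" using Re_hankel1_real assms False by simp
  have "(\<Sum>i\<le>j. of_real (rotation_coeff j i) * bessel_product x (j - i) (j + 1 + i) (of_real t)) =
    of_real (x * t * bessel_J0 (x * t)) *
     (\<Sum>i\<le>j. of_real (rotation_coeff j i) * of_real (bessel_J0 t) ^ (j - i) * ?h ^ (j + 1 + i))"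
    unfolding sum_distrib_left bessel_product_def J0_complex_real of_real_mult[symmetric]
    by (intro sum.cong refl) (simp only: of_real_mult mult_ac)
  then have "Re (\<Sum>i\<le>j. of_real (rotation_coeff j i) * bessel_product x (j - i) (j + 1 + i) (of_real t)) =
    x * t * bessel_J0 (x * t) * bessel_J0 t ^ (2 * j + 1)"
    using power_eq_Re_rotation_sum[of ?h j] unfolding Re
    by (simp only: Re_complex_of_real times_complex.sel Im_complex_of_real mult_zero_left diff_zero)
  then show ?thesis by (simp only: mult_ac)
qed (simp add: bessel_product_def)

lemma kluyver_density_eq_sum:
  assumes "0 < x" "x \<le> 1" "j \<ge> 2 \<or> (j \<ge> 1 \<and> x < 1)"
  shows "kluyver_density (2 * j + 1) x = (\<Sum>i\<le>j. rotation_coeff j i *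
    Re (integral {0..} (\<lambda>y. \<i> * bessel_product x (j - i) (j + 1 + i) (\<i> * of_real y))))"
proof -
  let ?G = "\<lambda>i. bessel_product x (j - i) (j + 1 + i)"
  let ?f = "\<lambda>t. bessel_J0 (x * t) * bessel_J0 t ^ (2 * j + 1) * x * t"
  define R where "R = (\<lambda>i T. integral {0..T} (\<lambda>t. ?G i (of_real t)))"
  define V where "V = (\<lambda>i T. integral {0..T} (\<lambda>y. \<i> * ?G i (\<i> * of_real y)))"
  define W where "W = (\<lambda>i. integral {0..} (\<lambda>y. \<i> * ?G i (\<i> * of_real y)))"
  have side: "j - i + (j + 1 + i) = 2 * j + 1" "0 \<le> real (j + 1 + i) - real (j - i) - x"
    "j \<ge> 2 \<or> (j \<ge> 1 \<and> 0 < real (j + 1 + i) - real (j - i) - x)" if "i \<in> {..j}" for i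
    using that assms by (auto simp: of_nat_diff)
  have cont: "continuous_on {0..T} (\<lambda>t. ?G i (of_real t))" "continuous_on {0..T} (\<lambda>y. \<i> * ?G i (\<i> * of_real y))" for i T
    by (intro continuous_intros continuous_on_compose2[OF continuous_on_bessel_product]; auto)+
  have RV: "((\<lambda>T. R i T - V i T) \<longlongrightarrow> 0) at_top" if "i \<in> {..j}" for i
    unfolding R_def V_def by (rule bessel_product_rotation[OF assms(1) _ side[OF that]]) auto
  have VW: "((\<lambda>T. V i T) \<longlongrightarrow> W i) at_top" if "i \<in> {..j}" for i
  proof -
    have "(\<lambda>y. \<i> * ?G i (\<i> * of_real y)) integrable_on {0..}"
      by (rule bessel_product_imaginary_integrable[OF assms(1) _ side[OF that]]) auto
    then have "((\<lambda>y. \<i> * ?G i (\<i> * of_real y)) has_integral W i) {0..}"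
      unfolding W_def by (rule integrable_integral)
    then show ?thesis
      unfolding V_def by (subst (asm) has_integral_atLeast_iff_tendsto) (intro integrable_continuous_interval cont)
  qed
  have RW: "((\<lambda>T. R i T) \<longlongrightarrow> W i) at_top" if "i \<in> {..j}" for i
    using tendsto_add[OF RV[OF that] VW[OF that]] by simp
  have "integral {0..T} ?f = Re (\<Sum>i\<le>j. of_real (rotation_coeff j i) * R i T)" for T
  proof -
    have I: "((\<lambda>t. Re (\<Sum>i\<le>j. of_real (rotation_coeff j i) * ?G i (of_real t))) has_integral
        Re (\<Sum>i\<le>j. of_real (rotation_coeff j i) * R i T)) {0..T}"
      unfolding R_def
      by (intro has_integral_Re has_integral_sum has_integral_mult_right integrable_integral
          integrable_continuous_interval cont) auto
    show ?thesis
      by (rule integral_unique[OF has_integral_eq[OF _ I]]) (simp only: kluyver_integrand_eq atLeastAtMost_iff)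
  qed
  moreover have "((\<lambda>T. Re (\<Sum>i\<le>j. of_real (rotation_coeff j i) * R i T)) \<longlongrightarrow>
      Re (\<Sum>i\<le>j. of_real (rotation_coeff j i) * W i)) at_top"
    by (intro tendsto_intros RW)
  ultimately have "((\<lambda>T. integral {0..T} ?f) \<longlongrightarrow> Re (\<Sum>i\<le>j. of_real (rotation_coeff j i) * W i)) at_top"
    by simp
  then have "(?f has_integral Re (\<Sum>i\<le>j. of_real (rotation_coeff j i) * W i)) {0..}"
    by (subst has_integral_atLeast_iff_tendsto)
      (auto simp: bessel_J0_eq_Re intro!: integrable_continuous_interval continuous_intros)
  then show ?thesis
    by (simp add: kluyver_density_def integral_unique W_def)
qed

text \<open>
  Continuity at 0, in spite of the singularity of \<open>K\<^sub>0\<close>, is inherited from \<open>bessel_product\<close>.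
\<close>

lemma continuous_IK_integrand:
  assumes "m < j"
  shows "continuous_on {0..} (\<lambda>t. bessel_I0 (x * t) * bessel_I0 t ^ (2 * m + 1) * (bessel_K0 t / pi) ^ (2 * (j - m)) * x * t)"
proof -
  have "continuous_on {0..} (\<lambda>y. (-1) ^ (j - m + 1) / 2 ^ (2 * (j - m)) * Re (\<i> * bessel_product x (2 * m + 1) (2 * (j - m)) (\<i> * of_real y)))"
    using assms by (intro continuous_intros continuous_on_compose2[OF continuous_on_bessel_product]) auto
  then show ?thesis
  proof (rule continuous_on_eq)
    fix t :: real assume "t \<in> {0..}"
    then have "t \<ge> 0" by simp
    have "(-1) ^ (j - m + 1) * (-1) ^ (j - m + 1) = (1::real)" by (simp add: power_mult_distrib[symmetric])
    then show "(-1) ^ (j - m + 1) / 2 ^ (2 * (j - m)) * Re (\<i> * bessel_product x (2 * m + 1) (2 * (j - m)) (\<i> * of_real t)) =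
       bessel_I0 (x * t) * bessel_I0 t ^ (2 * m + 1) * (bessel_K0 t / pi) ^ (2 * (j - m)) * x * t"
      unfolding Re_bessel_product_imaginary_even[OF \<open>t \<ge> 0\<close>] by (simp add: field_simps)
  qed
qed

lemma IK_integrand_has_integral:
  assumes "0 < x" "x \<le> 1" "j \<ge> 2 \<or> (j \<ge> 1 \<and> x < 1)" "2 * m + 1 \<le> j"
  shows "((\<lambda>t. bessel_I0 (x * t) * bessel_I0 t ^ (2 * m + 1) * (bessel_K0 t / pi) ^ (2 * (j - m)) * x * t)
      has_integral IK_integral j m x) {0..}"
    and "Re (integral {0..} (\<lambda>y. \<i> * bessel_product x (2 * m + 1) (2 * (j - m)) (\<i> * of_real y)))
      = (-1) ^ (j - m + 1) * 2 ^ (2 * (j - m)) * IK_integral j m x"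
proof -
  let ?f = "\<lambda>t. bessel_I0 (x * t) * bessel_I0 t ^ (2 * m + 1) * (bessel_K0 t / pi) ^ (2 * (j - m)) * x * t"
  define s :: real where "s = (-1) ^ (j - m + 1) * 2 ^ (2 * (j - m))"
  have "s \<noteq> 0" by (simp add: s_def)
  define W where "W = integral {0..} (\<lambda>y. \<i> * bessel_product x (2 * m + 1) (2 * (j - m)) (\<i> * of_real y))"
  have "(\<lambda>y. \<i> * bessel_product x (2 * m + 1) (2 * (j - m)) (\<i> * of_real y)) integrable_on {0..}"
    by (rule bessel_product_imaginary_integrable[of _ _ _ j]) (use assms in \<open>auto simp: of_nat_diff\<close>)
  then have "((\<lambda>y. Re (\<i> * bessel_product x (2 * m + 1) (2 * (j - m)) (\<i> * of_real y))) has_integral Re W) {0..}"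
    unfolding W_def by (intro has_integral_Re integrable_integral)
  then have "((\<lambda>t. s * ?f t) has_integral Re W) {0..}"
    by (rule has_integral_eq[rotated]) (simp only: Re_bessel_product_imaginary_even s_def atLeast_iff)
  from has_integral_mult_right[OF this, of "1 / s"]
  have f: "(?f has_integral (Re W / s)) {0..}" using \<open>s \<noteq> 0\<close> by simp
  then have IK: "IK_integral j m x = Re W / s" by (simp add: IK_integral_def integral_unique)
  from f show "(?f has_integral IK_integral j m x) {0..}" unfolding IK .
  show "Re (integral {0..} (\<lambda>y. \<i> * bessel_product x (2 * m + 1) (2 * (j - m)) (\<i> * of_real y)))
      = (-1) ^ (j - m + 1) * 2 ^ (2 * (j - m)) * IK_integral j m x"
    using \<open>s \<noteq> 0\<close> unfolding W_def[symmetric] s_def[symmetric] IK by simp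
qed

text \<open>
  In \<open>power_eq_Re_rotation_sum\<close> the exponent of \<open>h\<close> is \<open>j + 1 + i\<close>; it equals \<open>2 * (j - m)\<close>
  for \<open>i = j - 1 - 2 * m\<close>. The other factor is the constant that the rotation produces.
\<close>

definition IK_coeff :: "nat \<Rightarrow> nat \<Rightarrow> real" where
  "IK_coeff j m = rotation_coeff j (j - 1 - 2 * m) * ((-1) ^ (j - m + 1) * 2 ^ (2 * (j - m)))"

lemma IK_coeff_in_Rats: "IK_coeff j m \<in> \<rat>"
  unfolding IK_coeff_def by (intro Rats_mult Rats_power rotation_coeff_in_Rats) auto

lemma kluyver_density_eq_IK_sum:
  assumes "0 \<le> x" "x \<le> 1" "j \<ge> 2 \<or> (j \<ge> 1 \<and> x < 1)"
  shows "kluyver_density (2 * j + 1) x = (\<Sum>m | 2 * m + 1 \<le> j. IK_coeff j m * IK_integral j m x)"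
proof (cases "x = 0")
  case True
  then show ?thesis by (simp add: kluyver_density_def IK_integral_def)
next
  case False
  with assms have "x > 0" by simp
  define w where "w = (\<lambda>i. Re (integral {0..} (\<lambda>y. \<i> * bessel_product x (j - i) (j + 1 + i) (\<i> * of_real y))))"
  define A where "A = {m. 2 * m + 1 \<le> j}"
  have odd: "w i = 0" if "i \<le> j" "odd (j + 1 + i)" for i
  proof -
    have "(\<lambda>y. \<i> * bessel_product x (j - i) (j + 1 + i) (\<i> * of_real y)) integrable_on {0..}"
      by (rule bessel_product_imaginary_integrable[of _ _ _ j]) (use assms \<open>x > 0\<close> that in \<open>auto simp: of_nat_diff\<close>)
    from has_integral_Re[OF integrable_integral[OF this]]
    have "((\<lambda>y::real. 0) has_integral w i) {0..}"
      unfolding w_def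
      by (rule has_integral_eq[rotated]) (rule Re_bessel_product_imaginary_odd; use that in simp)
    then show ?thesis using has_integral_0 has_integral_unique by blast
  qed
  have even: "rotation_coeff j (j - 1 - 2 * m) * w (j - 1 - 2 * m) = IK_coeff j m * IK_integral j m x" if "m \<in> A" for m
  proof -
    have "j - (j - 1 - 2 * m) = 2 * m + 1" "j + 1 + (j - 1 - 2 * m) = 2 * (j - m)"
      using that by (auto simp: A_def)
    then show ?thesis
      using IK_integrand_has_integral(2)[OF \<open>x > 0\<close> assms(2,3), of m] that
      by (simp add: w_def IK_coeff_def A_def)
  qed
  have "kluyver_density (2 * j + 1) x = (\<Sum>i\<le>j. rotation_coeff j i * w i)"
    unfolding w_def by (rule kluyver_density_eq_sum[OF \<open>x > 0\<close> assms(2,3)])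
  also have "\<dots> = (\<Sum>i\<in>(\<lambda>m. j - 1 - 2 * m) ` A. rotation_coeff j i * w i)"
  proof (rule sum.mono_neutral_right)
    show "\<forall>i\<in>{..j} - (\<lambda>m. j - 1 - 2 * m) ` A. rotation_coeff j i * w i = 0"
    proof
      fix i assume i: "i \<in> {..j} - (\<lambda>m. j - 1 - 2 * m) ` A"
      have "odd (j + 1 + i)"
      proof (rule ccontr)
        assume "\<not> odd (j + 1 + i)"
        then have "even (j + 1 + i)" by simp
        then obtain r where r: "j + 1 + i = 2 * r" by (rule evenE)
        then have "i = j - 1 - 2 * (j - r)" "j - r \<in> A" using i by (auto simp: A_def)
        with i show False by blast
      qed
      then show "rotation_coeff j i * w i = 0" using odd i by simp
    qed
  qed auto
  also have "\<dots> = (\<Sum>m\<in>A. rotation_coeff j (j - 1 - 2 * m) * w (j - 1 - 2 * m))"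
    by (subst sum.reindex) (auto simp: inj_on_def A_def)
  also have "\<dots> = (\<Sum>m\<in>A. IK_coeff j m * IK_integral j m x)" by (rule sum.cong[OF refl even])
  finally show ?thesis by (simp add: A_def)
qed

section \<open>Positivity and decay\<close>

lemma bessel_I0_ge_partial_sum: "(\<Sum>k<n. (t / 2) ^ (2 * k) / (fact k)\<^sup>2) \<le> bessel_I0 t"
proof -
  have "(\<Sum>k<n. (t / 2) ^ (2 * k) / (fact k)\<^sup>2) \<le> (\<Sum>k. (t / 2) ^ (2 * k) / (fact k)\<^sup>2)"
    using bessel_I0_sums[of t] by (intro sum_le_suminf) (auto simp: sums_iff zero_le_even_power)
  then show ?thesis using bessel_I0_sums[of t] by (simp add: sums_iff)
qed

lemma bessel_I0_ge_1: "1 \<le> bessel_I0 t"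
  using bessel_I0_ge_partial_sum[of t 1] by simp

lemma continuous_on_bessel_I0 [continuous_intros]:
  assumes "continuous_on S f"
  shows "continuous_on S (\<lambda>t. bessel_I0 (f t))"
proof -
  have "bessel_I0 t = Re (J0_complex (\<i> * of_real t))" for t by (simp add: J0_complex_imaginary)
  then show ?thesis using assms by (auto intro!: continuous_intros)
qed

lemma bessel_K0_pos:
  assumes "y > 0"
  shows "0 < bessel_K0 y"
proof -
  have "((\<lambda>u::real. exp (- y * cosh 1)) has_integral exp (- y * cosh 1) * (1 - 0)) {0..1}"
    using has_integral_const_real[of "exp (- y * cosh 1)" 0 1] by simp
  then have "((\<lambda>u::real. if u \<in> {0..1} then exp (- y * cosh 1) else 0) has_integral exp (- y * cosh 1)) {0..}"
    by (subst has_integral_restrict) auto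
  from has_integral_le[OF this K0_upper_imaginary(2)[OF assms]]
  have "exp (- y * cosh 1) \<le> bessel_K0 y"
    using assms cosh_real_nonneg_le_iff by force
  then show ?thesis using exp_gt_zero less_le_trans by blast
qed

lemma bessel_K0_tendsto_0: "(bessel_K0 \<longlongrightarrow> 0) at_top"
proof (rule Lim_null_comparison)
  show "\<forall>\<^sub>F y in at_top. norm (bessel_K0 y) \<le> exp (- y) * (1 + 2 / sinh (1::real))"
    using eventually_ge_at_top[of 1]
  proof eventually_elim
    case (elim y)
    have "norm (bessel_K0 y) \<le> exp (- y) * (1 + 2 / (y * sinh 1))"
      using norm_K0_upper_le[of "\<i> * of_real y" 1] elim
      by (simp add: K0_upper_imaginary(1) norm_mult)
    also have "\<dots> \<le> exp (- y) * (1 + 2 / (1 * sinh 1))"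
      using elim by (intro mult_left_mono add_left_mono divide_left_mono mult_right_mono mult_pos_pos) auto
    finally show ?case by simp
  qed
  have "((\<lambda>y::real. exp (- y)) \<longlongrightarrow> 0) at_top"
    by (rule filterlim_compose[OF exp_at_bot filterlim_uminus_at_bot_at_top])
  then show "((\<lambda>y. exp (- y) * (1 + 2 / sinh (1::real))) \<longlongrightarrow> 0) at_top"
    by (rule tendsto_mult_left_zero)
qed

lemma powser_eq_0_imp_coeff_eq_0:
  fixes b :: "nat \<Rightarrow> real"
  assumes "\<And>y. 0 < y \<Longrightarrow> y < 1 \<Longrightarrow> (\<lambda>k. b k * y ^ k) sums 0"
  shows "b k = 0"
proof (induction k rule: less_induct)
  case (less k)
  have sums: "(\<lambda>n. b (n + k) * y ^ n) sums 0" if y: "0 < y" "y < 1" for y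
  proof -
    have "(\<lambda>n. b (n + k) * y ^ (n + k)) sums (0 - (\<Sum>i<k. b i * y ^ i))"
      by (rule sums_split_initial_segment[OF assms[OF y]])
    then have "(\<lambda>n. b (n + k) * y ^ (n + k)) sums 0" using less by simp
    from sums_mult2[OF this, of "1 / y ^ k"] show ?thesis using y by (simp add: power_add)
  qed
  define f where "f = (\<lambda>y. \<Sum>n. b (n + k) * y ^ n)"
  have "(\<lambda>n. b (n + k) * y ^ n) sums f y" if "norm y < 1 / 2" for y
    unfolding f_def
    by (rule summable_sums, rule powser_inside[OF sums_summable[OF sums[of "1/2"]]]) (use that in auto)
  from powser_limit_0[of "1/2", OF _ this] have "(f \<longlongrightarrow> b (0 + k)) (at 0)" by simp
  then have "(f \<longlongrightarrow> b (0 + k)) (at_right 0)" by (rule tendsto_mono[OF at_le[OF subset_UNIV]])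
  moreover have "\<forall>\<^sub>F y in at_right 0. f y = 0"
    using eventually_at_right_real[of 0 1]
    by (auto elim!: eventually_mono simp: f_def sums_unique[OF sums, symmetric])
  ultimately have "((\<lambda>_. 0) \<longlongrightarrow> b (0 + k)) (at_right (0::real))"
    by (rule Lim_transform_eventually)
  then show ?case by (simp add: tendsto_const_iff)
qed

section \<open>Linear independence\<close>

text \<open>
  If \<open>G\<close> is positive beyond \<open>T\<close>, then \<open>t ^ (2 * k) * G t\<close> gains a factor \<open>4 ^ k\<close> on
  \<open>{2*T..3*T}\<close> over anything that it can lose on \<open>{0..T}\<close>, so a high enough moment is
  positive.
\<close>

lemma vanishing_moments_imp_not_eventually_pos:
  fixes G :: "real \<Rightarrow> real"
  assumes cont: "continuous_on {0..} G"
    and moments: "\<And>k. ((\<lambda>t. t ^ (2 * k) * G t) has_integral 0) {0..}"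
  shows "\<not> (\<forall>\<^sub>F t in at_top. 0 < G t)"
proof
  assume "\<forall>\<^sub>F t in at_top. 0 < G t"
  then obtain T0 where T0: "\<And>t. T0 \<le> t \<Longrightarrow> 0 < G t" by (auto simp: eventually_at_top_linorder)
  define T where "T = max T0 1"
  have T: "T > 0" "\<And>t. T \<le> t \<Longrightarrow> 0 < G t" using T0 by (auto simp: T_def)
  have "bounded (G ` {0..T})"
    by (intro compact_imp_bounded compact_continuous_image continuous_on_subset[OF cont]) auto
  then obtain N where "\<forall>z\<in>G ` {0..T}. norm z \<le> N" by (auto simp: bounded_iff)
  then have N: "\<bar>G t\<bar> \<le> N" if "t \<in> {0..T}" for t using that by auto
  obtain s where s: "s \<in> {2*T..3*T}" "\<And>t. t \<in> {2*T..3*T} \<Longrightarrow> G s \<le> G t"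
    using continuous_attains_inf[of "{2*T..3*T}" G] T continuous_on_subset[OF cont, of "{2*T..3*T}"] by auto
  define c where "c = G s"
  have "c > 0" using T s by (auto simp: c_def)
  have "4 ^ k * c \<le> N" for k
  proof -
    \<comment> \<open>A step function below \<open>t ^ (2 * k) * G t\<close>.\<close>
    let ?h = "\<lambda>t. (if t \<in> {0..T} then - (T ^ (2 * k) * N) else 0) + (if t \<in> {2*T..3*T} then (2 * T) ^ (2 * k) * c else 0)"
    have 1: "((\<lambda>t. if t \<in> {0..T} then - (T ^ (2 * k) * N) else 0) has_integral T * - (T ^ (2 * k) * N)) {0..}"
      using has_integral_const_real[of "- (T ^ (2 * k) * N)" 0 T] T by (subst has_integral_restrict) auto
    have 2: "((\<lambda>t. if t \<in> {2*T..3*T} then (2 * T) ^ (2 * k) * c else 0) has_integral T * ((2 * T) ^ (2 * k) * c)) {0..}"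
      using has_integral_const_real[of "(2 * T) ^ (2 * k) * c" "2*T" "3*T"] T by (subst has_integral_restrict) auto
    have "T * - (T ^ (2 * k) * N) + T * ((2 * T) ^ (2 * k) * c) \<le> 0"
    proof (rule has_integral_le[OF has_integral_add[OF 1 2] moments])
      fix t :: real assume "t \<in> {0..}"
      then consider "t \<in> {0..T}" | "t \<in> {2*T..3*T}" "t \<notin> {0..T}" | "t \<notin> {2*T..3*T}" "t \<notin> {0..T}" "T < t" by force
      then show "?h t \<le> t ^ (2 * k) * G t"
      proof cases
        case 1
        have "t ^ (2 * k) * (- G t) \<le> t ^ (2 * k) * \<bar>G t\<bar>"
          by (intro mult_left_mono) (auto simp: zero_le_even_power)
        also have "\<dots> \<le> T ^ (2 * k) * N" using 1 N[OF 1] by (intro mult_mono power_mono) auto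
        finally have "- (T ^ (2 * k) * N) \<le> t ^ (2 * k) * G t" by simp
        then show ?thesis using 1 T(1) by auto
      next
        case 2
        have "(2 * T) ^ (2 * k) * c \<le> t ^ (2 * k) * G t"
          using 2 T s(2)[OF 2(1)] \<open>c > 0\<close> by (intro mult_mono power_mono) (auto simp: c_def)
        then show ?thesis using 2 by auto
      next
        case 3
        then show ?thesis using T(2)[of t] T(1) by (auto intro!: mult_nonneg_nonneg)
      qed
    qed
    moreover have "(2 * T) ^ (2 * k) = 4 ^ k * T ^ (2 * k)"
      by (simp only: power_mult power_mult_distrib) simp
    ultimately have "T * (T ^ (2 * k) * (4 ^ k * c)) \<le> T * (T ^ (2 * k) * N)"
      by (simp only:) (simp add: algebra_simps)
    then show ?thesis using T(1) by simp
  qed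
  moreover obtain k where "N / c < 4 ^ k" using real_arch_pow[of 4 "N / c"] by auto
  then have "N < 4 ^ k * c" using \<open>c > 0\<close> by (simp add: pos_divide_less_eq)
  ultimately show False by (meson not_le)
qed

text \<open>
  The integrand of \<open>IK_integral\<close> without the factor \<open>x * bessel_I0 (x * t)\<close>, so that all
  dependence on \<open>x\<close> sits in a common kernel.
\<close>

definition IK_weight :: "nat \<Rightarrow> nat \<Rightarrow> real \<Rightarrow> real" where
  "IK_weight j m t = bessel_I0 t ^ (2 * m + 1) * (bessel_K0 t / pi) ^ (2 * (j - m)) * t"

lemma continuous_on_IK_weight:
  assumes "m < j"
  shows "continuous_on {0..} (IK_weight j m)"
proof -
  have pos: "bessel_I0 t > 0" for t using bessel_I0_ge_1[of t] by linarith
  have "continuous_on {0..} (\<lambda>t. bessel_I0 (1 * t) * bessel_I0 t ^ (2 * m + 1) * (bessel_K0 t / pi) ^ (2 * (j - m)) * 1 * t / bessel_I0 t)"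
    by (intro continuous_on_divide continuous_IK_integrand assms continuous_intros) (use pos in \<open>auto simp: less_le\<close>)
  then show ?thesis
    by (rule continuous_on_eq) (use pos in \<open>simp add: IK_weight_def less_le\<close>)
qed

lemma IK_weight_nonneg: "t \<ge> 0 \<Longrightarrow> 0 \<le> IK_weight j m t"
  unfolding IK_weight_def using bessel_I0_ge_1[of t] by (intro mult_nonneg_nonneg) auto

lemma IK_weight_pos: "t > 0 \<Longrightarrow> 0 < IK_weight j m t"
  unfolding IK_weight_def using bessel_I0_ge_1[of t] bessel_K0_pos[of t] by (intro mult_pos_pos) auto

lemma IK_weight_has_integral:
  assumes "0 < x" "x < 1" "2 * m + 1 \<le> j"
  shows "((\<lambda>t. bessel_I0 (x * t) * IK_weight j m t) has_integral IK_integral j m x / x) {0..}"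
proof -
  from assms have "((\<lambda>t. bessel_I0 (x * t) * bessel_I0 t ^ (2 * m + 1) * (bessel_K0 t / pi) ^ (2 * (j - m)) * x * t)
      has_integral IK_integral j m x) {0..}"
    by (intro IK_integrand_has_integral) auto
  from has_integral_mult_right[OF this, of "1 / x"] show ?thesis
    using assms by (simp add: IK_weight_def mult_ac)
qed

text \<open>
  For \<open>m < M\<close> the quotient of the weights of index \<open>m\<close> and \<open>M\<close> is the power \<open>2 * (M - m)\<close> of
  \<open>K\<^sub>0 / (\<pi> I\<^sub>0)\<close>, which tends to 0. So the weight with the largest index dominates.
\<close>

lemma IK_weight_combination_tendsto:
  assumes "finite A" "M \<in> A" "\<And>m. m \<in> A \<Longrightarrow> M < m \<Longrightarrow> d m = 0" "M \<le> j"
  shows "((\<lambda>t. (\<Sum>m\<in>A. d m * IK_weight j m t) / IK_weight j M t) \<longlongrightarrow> d M) at_top"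
proof -
  define q where "q = (\<lambda>t. bessel_K0 t / pi / bessel_I0 t)"
  have "(q \<longlongrightarrow> 0) at_top"
  proof (rule Lim_null_comparison)
    show "\<forall>\<^sub>F t in at_top. norm (q t) \<le> bessel_K0 t / pi"
      using eventually_gt_at_top[of 0]
    proof eventually_elim
      case (elim t)
      have "bessel_K0 t / pi / bessel_I0 t \<le> bessel_K0 t / pi / 1"
        using bessel_I0_ge_1[of t] bessel_K0_pos[OF elim] by (intro divide_left_mono) auto
      then show ?case using bessel_I0_ge_1[of t] bessel_K0_pos[OF elim] by (simp add: q_def)
    qed
    show "((\<lambda>t. bessel_K0 t / pi) \<longlongrightarrow> 0) at_top"
      using tendsto_divide[OF bessel_K0_tendsto_0 tendsto_const[of pi]] by simp
  qed
  then have "((\<lambda>t. \<Sum>m\<in>A. d m * q t ^ (2 * (M - m))) \<longlongrightarrow> (\<Sum>m\<in>A. d m * 0 ^ (2 * (M - m)))) at_top"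
    by (intro tendsto_intros)
  moreover have "(\<Sum>m\<in>A. d m * 0 ^ (2 * (M - m))) = (\<Sum>m\<in>A. if m = M then d M else 0)"
    using assms(3) by (intro sum.cong) (auto simp: power_0_left)
  moreover have "\<dots> = d M" using assms by simp
  moreover have "\<forall>\<^sub>F t in at_top. (\<Sum>m\<in>A. d m * q t ^ (2 * (M - m))) = (\<Sum>m\<in>A. d m * IK_weight j m t) / IK_weight j M t"
    using eventually_gt_at_top[of 0]
  proof eventually_elim
    case (elim t)
    show ?case unfolding sum_divide_distrib
    proof (rule sum.cong)
      fix m assume m: "m \<in> A"
      show "d m * q t ^ (2 * (M - m)) = d m * IK_weight j m t / IK_weight j M t"
      proof (cases "m \<le> M")
        case True
        have "IK_weight j m t = IK_weight j M t * q t ^ (2 * (M - m))"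
        proof -
          define I k where "I = bessel_I0 t" and "k = bessel_K0 t / pi"
          have "I > 0" using bessel_I0_ge_1[of t] by (simp add: I_def)
          have e: "2 * M + 1 = (2 * m + 1) + 2 * (M - m)" "2 * (j - m) = 2 * (j - M) + 2 * (M - m)"
            using True \<open>M \<le> j\<close> by auto
          show ?thesis
            unfolding IK_weight_def q_def I_def[symmetric] k_def[symmetric] e power_add power_divide
            using \<open>I > 0\<close> by simp
        qed
        then show ?thesis using IK_weight_pos[OF elim, of j M] by simp
      qed (use assms(3)[OF m] in auto)
    qed simp
  qed
  ultimately show ?thesis using Lim_transform_eventually by fastforce
qed

text \<open>
  A linear relation says that \<open>\<integral> I\<^sub>0(x t) G(t) dt\<close> vanishes for \<open>0 < x < 1\<close>, where \<open>G\<close> is a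
  combination of the weights, here normalised to have leading coefficient 1. Expanding
  \<open>I\<^sub>0(x t)\<close> in powers of \<open>x\<close> shows that all even moments of \<open>G\<close> are 0. But \<open>G\<close> is positive
  near infinity, as its leading weight is.
\<close>

lemma IK_integrals_independent:
  assumes zero: "\<And>x. 0 < x \<Longrightarrow> x < 1 \<Longrightarrow> (\<Sum>m | 2 * m + 1 \<le> j. d m * IK_integral j m x) = 0"
    and m0: "2 * m0 + 1 \<le> j"
  shows "d m0 = 0"
proof (rule ccontr)
  assume "d m0 \<noteq> 0"
  define A where "A = {m. 2 * m + 1 \<le> j}"
  have "A \<subseteq> {..j}" by (auto simp: A_def)
  then have "finite A" by (rule finite_subset) simp
  define M where "M = Max {m \<in> A. d m \<noteq> 0}"
  have fin: "finite {m \<in> A. d m \<noteq> 0}" and ne: "{m \<in> A. d m \<noteq> 0} \<noteq> {}"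
    using \<open>finite A\<close> \<open>d m0 \<noteq> 0\<close> m0 by (auto simp: A_def)
  have M: "M \<in> A" "d M \<noteq> 0" using Max_in[OF fin ne] by (auto simp: M_def)
  have M_max: "d m = 0" if "m \<in> A" "M < m" for m
    using Max_ge[OF fin, of m] that by (force simp: M_def)
  have lt: "m < j" if "m \<in> A" for m using that by (auto simp: A_def)
  define G where "G = (\<lambda>t. (\<Sum>m\<in>A. d m * IK_weight j m t) / d M)"
  \<comment> \<open>The majorant \<open>H\<close> justifies integrating the power series of \<open>I\<^sub>0(x t)\<close> term by term.\<close>
  define H where "H = (\<lambda>t. (\<Sum>m\<in>A. \<bar>d m\<bar> * IK_weight j m t) / \<bar>d M\<bar>)"
  have contG: "continuous_on {0..} G"
    unfolding G_def using M lt by (intro continuous_intros continuous_on_IK_weight) auto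
  have GH: "\<bar>G t\<bar> \<le> H t" if "t \<ge> 0" for t
  proof -
    have "\<bar>\<Sum>m\<in>A. d m * IK_weight j m t\<bar> \<le> (\<Sum>m\<in>A. \<bar>d m * IK_weight j m t\<bar>)" by (rule sum_abs)
    also have "\<dots> = (\<Sum>m\<in>A. \<bar>d m\<bar> * IK_weight j m t)"
      using IK_weight_nonneg[OF that] by (simp add: abs_mult)
    finally show ?thesis unfolding G_def H_def abs_divide by (rule divide_right_mono) simp
  qed
  have G_int: "((\<lambda>t. bessel_I0 (x * t) * G t) has_integral 0) {0..}" if x: "0 < x" "x < 1" for x
  proof -
    have "((\<lambda>t. (\<Sum>m\<in>A. d m * (bessel_I0 (x * t) * IK_weight j m t)) / d M) has_integral
       (\<Sum>m\<in>A. d m * (IK_integral j m x / x)) / d M) {0..}"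
      by (intro has_integral_divide has_integral_sum has_integral_mult_right IK_weight_has_integral x \<open>finite A\<close>)
        (auto simp: A_def)
    moreover have "(\<Sum>m\<in>A. d m * (IK_integral j m x / x)) = 0"
      using zero[OF x] by (simp add: A_def sum_divide_distrib[symmetric])
    moreover have "(\<lambda>t. (\<Sum>m\<in>A. d m * (bessel_I0 (x * t) * IK_weight j m t)) / d M) = (\<lambda>t. bessel_I0 (x * t) * G t)"
      by (simp add: G_def sum_distrib_left mult_ac)
    ultimately show ?thesis by simp
  qed
  have H_int: "(\<lambda>t. bessel_I0 (x * t) * H t) integrable_on {0..}" if x: "0 < x" "x < 1" for x
  proof -
    have "((\<lambda>t. (\<Sum>m\<in>A. \<bar>d m\<bar> * (bessel_I0 (x * t) * IK_weight j m t)) / \<bar>d M\<bar>) has_integral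
       (\<Sum>m\<in>A. \<bar>d m\<bar> * (IK_integral j m x / x)) / \<bar>d M\<bar>) {0..}"
      by (intro has_integral_divide has_integral_sum has_integral_mult_right IK_weight_has_integral x \<open>finite A\<close>)
        (auto simp: A_def)
    moreover have "(\<lambda>t. (\<Sum>m\<in>A. \<bar>d m\<bar> * (bessel_I0 (x * t) * IK_weight j m t)) / \<bar>d M\<bar>) = (\<lambda>t. bessel_I0 (x * t) * H t)"
      by (simp add: H_def sum_distrib_left mult_ac)
    ultimately show ?thesis by (auto simp: integrable_on_def)
  qed
  define p where "p = (\<lambda>n x t. \<Sum>k<n. (x * t / 2 :: real) ^ (2 * k) / (fact k)\<^sup>2)"
  have p_nonneg: "0 \<le> p n x t" for n x t
    unfolding p_def by (intro sum_nonneg divide_nonneg_nonneg) (auto simp: zero_le_even_power)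
  have p_le: "norm (p n x t * G t) \<le> bessel_I0 (x * t) * H t" if "t \<ge> 0" for n x t
    unfolding real_norm_def abs_mult
    using GH[OF that] p_nonneg[of n x t] bessel_I0_ge_partial_sum[where n = n and t = "x * t"] bessel_I0_ge_1[of "x * t"]
    by (intro mult_mono) (auto simp: p_def)
  have t2k: "(\<lambda>t. t ^ (2 * k) * G t) integrable_on {0..}" for k
  proof -
    \<comment> \<open>The factor of \<open>t ^ (2 * k)\<close> in the power series of \<open>bessel_I0 (t / 2)\<close>: the moment is dominated by the integral at \<open>x = 1/2\<close>.\<close>
    define a where "a = (1 / 4 :: real) ^ (2 * k) / (fact k)\<^sup>2"
    have "a > 0" by (simp add: a_def)
    have "(\<lambda>t. a * (t ^ (2 * k) * G t)) integrable_on {0..}"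
    proof (rule measurable_bounded_by_integrable_imp_integrable[OF _ H_int[of "1/2"]])
      show "(\<lambda>t. a * (t ^ (2 * k) * G t)) \<in> borel_measurable (lebesgue_on {0..})"
        by (intro continuous_imp_measurable_on_sets_lebesgue continuous_intros contG) auto
      fix t :: real assume "t \<in> {0..}"
      then have "t \<ge> 0" by simp
      have "a * t ^ (2 * k) = (1 / 2 * t / 2) ^ (2 * k) / (fact k)\<^sup>2"
        by (simp add: a_def power_mult_distrib[symmetric] power_divide)
      also have "\<dots> \<le> p (Suc k) (1/2) t"
        unfolding p_def by (rule member_le_sum) (auto simp: zero_le_even_power)
      finally have "norm (a * (t ^ (2 * k) * G t)) \<le> norm (p (Suc k) (1/2) t * G t)"
        using \<open>a > 0\<close> \<open>t \<ge> 0\<close> p_nonneg[of "Suc k" "1/2" t]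
        by (simp add: abs_mult mult.assoc[symmetric] mult_right_mono)
      then show "norm (a * (t ^ (2 * k) * G t)) \<le> bessel_I0 (1 / 2 * t) * H t"
        using p_le[OF \<open>t \<ge> 0\<close>] by (rule order_trans)
    qed auto
    from integrable_on_mult_right[OF this, of "1 / a"] show ?thesis using \<open>a > 0\<close> by simp
  qed
  define mom where "mom = (\<lambda>k. integral {0..} (\<lambda>t. t ^ (2 * k) * G t))"
  have mom: "((\<lambda>t. t ^ (2 * k) * G t) has_integral mom k) {0..}" for k
    unfolding mom_def by (rule integrable_integral[OF t2k])
  have sums: "(\<lambda>k. (mom k / (4 ^ k * (fact k)\<^sup>2)) * y ^ k) sums 0" if y: "0 < y" "y < 1" for y
  proof -
    define x where "x = sqrt y"
    have x: "0 < x" "x < 1" "x\<^sup>2 = y" using y by (auto simp: x_def)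
    have pG: "((\<lambda>t. p n x t * G t) has_integral (\<Sum>k<n. (mom k / (4 ^ k * (fact k)\<^sup>2)) * y ^ k)) {0..}" for n
    proof -
      have "((\<lambda>t. \<Sum>k<n. y ^ k / (4 ^ k * (fact k)\<^sup>2) * (t ^ (2 * k) * G t)) has_integral
          (\<Sum>k<n. y ^ k / (4 ^ k * (fact k)\<^sup>2) * mom k)) {0..}"
        by (intro has_integral_sum has_integral_mult_right mom) auto
      moreover have "p n x t * G t = (\<Sum>k<n. y ^ k / (4 ^ k * (fact k)\<^sup>2) * (t ^ (2 * k) * G t))" for t
      proof -
        have "(x * t / 2) ^ (2 * k) / (fact k)\<^sup>2 * G t = y ^ k / (4 ^ k * (fact k)\<^sup>2) * (t ^ (2 * k) * G t)" for k
        proof -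
          have "(x * t / 2) ^ (2 * k) = y ^ k * t ^ (2 * k) / 4 ^ k"
            unfolding x(3)[symmetric] by (simp add: power_mult power_mult_distrib power_divide)
          then show ?thesis by simp
        qed
        then show ?thesis by (simp add: p_def sum_distrib_right)
      qed
      ultimately show ?thesis by (simp add: mult.commute)
    qed
    have "(\<lambda>n. integral {0..} (\<lambda>t. p n x t * G t)) \<longlonglongrightarrow> integral {0..} (\<lambda>t. bessel_I0 (x * t) * G t)"
    proof (rule dominated_convergence(2)[OF _ H_int[OF x(1,2)]])
      show "(\<lambda>t. p n x t * G t) integrable_on {0..}" for n using pG by (rule has_integral_integrable)
      show "norm (p n x t * G t) \<le> bessel_I0 (x * t) * H t" if "t \<in> {0..}" for n t
        using p_le that by simp
      show "(\<lambda>n. p n x t * G t) \<longlonglongrightarrow> bessel_I0 (x * t) * G t" if "t \<in> {0..}" for t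
        using bessel_I0_sums[of "x * t"] unfolding p_def sums_def by (intro tendsto_intros)
    qed
    then show ?thesis
      unfolding sums_def integral_unique[OF pG] integral_unique[OF G_int[OF x(1,2)]] .
  qed
  have "mom k = 0" for k
    using powser_eq_0_imp_coeff_eq_0[OF sums, of k] by simp
  with mom have "((\<lambda>t. t ^ (2 * k) * G t) has_integral 0) {0..}" for k by metis
  moreover have "\<forall>\<^sub>F t in at_top. 0 < G t"
  proof -
    have "((\<lambda>t. (\<Sum>m\<in>A. d m * IK_weight j m t) / IK_weight j M t / d M) \<longlongrightarrow> d M / d M) at_top"
      using M lt[OF M(1)] by (intro tendsto_divide tendsto_const IK_weight_combination_tendsto \<open>finite A\<close> M_max) auto
    then have "\<forall>\<^sub>F t in at_top. 0 < (\<Sum>m\<in>A. d m * IK_weight j m t) / IK_weight j M t / d M"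
      using M by (intro order_tendstoD(1)) auto
    then show ?thesis
      using eventually_gt_at_top[of 0]
    proof eventually_elim
      case (elim t)
      then have "0 < G t / IK_weight j M t" by (simp add: G_def mult.commute)
      then show ?case using IK_weight_pos[OF elim(2), of j M] by (simp add: zero_less_divide_iff)
    qed
  qed
  ultimately show False using vanishing_moments_imp_not_eventually_pos[OF contG] by blast
qed

section \<open>The representation and its uniqueness\<close>

lemma IK_combination_unique:
  assumes "j \<ge> 1" and X: "{0<..<1} \<subseteq> X" "X \<subseteq> {0..1}" "j \<ge> 2 \<or> 1 \<notin> X"
  shows "\<exists>!c :: nat \<Rightarrow> real. c \<in> {m. real m \<le> (real j - 1) / 2} \<rightarrow>\<^sub>E \<rat> \<and>
        (\<forall>x\<in>X. kluyver_density (2 * j + 1) x =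
           (\<Sum>m | real m \<le> (real j - 1) / 2. c m * IK_integral j m x))"
proof -
  have "real m \<le> (real j - 1) / 2 \<longleftrightarrow> real (2 * m + 1) \<le> real j" for m
    by (simp add: field_simps)
  then have "real m \<le> (real j - 1) / 2 \<longleftrightarrow> 2 * m + 1 \<le> j" for m
    by (simp only: of_nat_le_iff)
  then have eq: "{m. real m \<le> (real j - 1) / 2} = {m. 2 * m + 1 \<le> j}" by simp
  define A where "A = {m. 2 * m + 1 \<le> j}"
  have rep: "kluyver_density (2 * j + 1) x = (\<Sum>m\<in>A. IK_coeff j m * IK_integral j m x)" if "x \<in> X" for x
  proof -
    have "0 \<le> x" "x \<le> 1" using that X by auto
    moreover from this have "j \<ge> 2 \<or> (j \<ge> 1 \<and> x < 1)" using that X(3) \<open>j \<ge> 1\<close> by (cases "x = 1") auto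
    ultimately show ?thesis unfolding A_def by (rule kluyver_density_eq_IK_sum)
  qed
  show ?thesis unfolding eq A_def[symmetric]
  proof (rule ex1I)
    show "restrict (IK_coeff j) A \<in> A \<rightarrow>\<^sub>E \<rat> \<and>
       (\<forall>x\<in>X. kluyver_density (2 * j + 1) x = (\<Sum>m\<in>A. restrict (IK_coeff j) A m * IK_integral j m x))"
      using IK_coeff_in_Rats rep by auto
  next
    fix c assume c: "c \<in> A \<rightarrow>\<^sub>E \<rat> \<and>
       (\<forall>x\<in>X. kluyver_density (2 * j + 1) x = (\<Sum>m\<in>A. c m * IK_integral j m x))"
    have "c m - IK_coeff j m = 0" if "m \<in> A" for m
    proof (rule IK_integrals_independent[where d = "\<lambda>m. c m - IK_coeff j m"])
      fix x :: real assume "0 < x" "x < 1"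
      then have "x \<in> X" using X(1) by auto
      with c rep have "(\<Sum>m\<in>A. c m * IK_integral j m x) = (\<Sum>m\<in>A. IK_coeff j m * IK_integral j m x)"
        by metis
      then show "(\<Sum>m | 2 * m + 1 \<le> j. (c m - IK_coeff j m) * IK_integral j m x) = 0"
        unfolding A_def[symmetric] by (simp add: left_diff_distrib sum_subtractf)
    qed (use that in \<open>simp add: A_def\<close>)
    then show "c = restrict (IK_coeff j) A"
      using c by (intro ext) (auto simp: PiE_def extensional_def)
  qed
qed

theorem theorem5p1:
  "(\<forall>j::nat. j > 1 \<longrightarrow>
      (\<exists>!c :: nat \<Rightarrow> real. c \<in> {m. real m \<le> (real j - 1) / 2} \<rightarrow>\<^sub>E \<rat> \<and>
        (\<forall>x\<in>{0..1}. kluyver_density (2 * j + 1) x =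
           (\<Sum>m | real m \<le> (real j - 1) / 2. c m * IK_integral j m x)))) \<and>
   (\<forall>j::nat. j = 1 \<longrightarrow>
      (\<exists>!c :: nat \<Rightarrow> real. c \<in> {m. real m \<le> (real j - 1) / 2} \<rightarrow>\<^sub>E \<rat> \<and>
        (\<forall>x\<in>{0..<1}. kluyver_density (2 * j + 1) x =
           (\<Sum>m | real m \<le> (real j - 1) / 2. c m * IK_integral j m x))))"
proof (intro conjI allI impI)
  fix j :: nat
  assume "j > 1"
  then show "\<exists>!c :: nat \<Rightarrow> real. c \<in> {m. real m \<le> (real j - 1) / 2} \<rightarrow>\<^sub>E \<rat> \<and>
        (\<forall>x\<in>{0..1}. kluyver_density (2 * j + 1) x =
           (\<Sum>m | real m \<le> (real j - 1) / 2. c m * IK_integral j m x))"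
    by (intro IK_combination_unique) auto
next
  fix j :: nat
  assume "j = 1"
  then show "\<exists>!c :: nat \<Rightarrow> real. c \<in> {m. real m \<le> (real j - 1) / 2} \<rightarrow>\<^sub>E \<rat> \<and>
        (\<forall>x\<in>{0..<1}. kluyver_density (2 * j + 1) x =
           (\<Sum>m | real m \<le> (real j - 1) / 2. c m * IK_integral j m x))"
    by (intro IK_combination_unique) auto
qed

end
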